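(* Let $n\geq 2$ and let $f$ be a polynomial with $n+3$ monomials in $n$ variables (real coefficients, real exponents affinely spanning $\mathbb{R}^n$), with smooth zero set $V(f)\subset\mathbb{R}^n_{>}$. Let $\overline{\Delta}$ be the closure in $\mathbb{RP}^2$ of the polyhedron $\Delta\subset\mathbb{R}^2_{>}$ associated to $f$ (see context, with $k=2$). Then $\overline{\Delta}$ is a polygon with $\Phi_1^{\ell}(\overline{\Delta})\leq 2$, $\Phi_1^{n\ell}(\overline{\Delta})\leq 2$ and $\Phi_0(\overline{\Delta})\leq 4$. Thus the number $\kappa(f)$ of compact connected components of $V(f)$ satisfies \[ \kappa(f)\ \leq\ \left\lfloor\frac{5n+1}{2}\right\rfloor. \]
   Context: $\mathbb{R}^m_{>}$ is the open positive orthant; a polynomial with real exponents is a real linear combination of monomials $z^w$, $w\in\mathbb{R}^n$. "$V(f)$ smooth" means that $df$ does not vanish at any point of $V(f)$. The polyhedron $\Delta$ (for $f$ with $n+k+1$ monomials): after an analytic change of variables on $\mathbb{R}^n_{>}$ one may assume $f=\sum_{i=1}^n e_iz_i+c_1z^{a_1}+\dotsb+c_kz^{a_k}+e_0$ with $e_i\in\{\pm1\}$, $a_j\in\mathbb{R}^n$, $c_j\neq0$. Solving the system $f=z_2\,\partial f/\partial z_2=\dotsb=z_n\,\partial f/\partial z_n=0$ (critical points of $z_1$ on $V(f)$) for $z_1,\dotsc,z_n$ gives $z_i=p_i(z^{a_1},\dotsc,z^{a_k})$, where $p_1(y)=b_{1,0}+b_{1,1}y_1+\dotsb+b_{1,k}y_k$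 and $p_i(y)=b_{i,1}y_1+\dotsb+b_{i,k}y_k$ for $i=2,\dotsc,n$ (no constant term). The parameters are assumed, after a small perturbation, to be sufficiently general, so the $p_i$ are general subject to the vanishing of these constant terms. Then $\Delta:=\{y\in\mathbb{R}^k_{>}\mid p_i(y)>0,\ i=1,\dotsc,n\}$ (assumed nonempty). Put $p_{n+j}=y_j$. The forms $p_2,\dotsc,p_{n+k}$ define a cone with vertex at the origin and with base a polytope $\phi^\infty$ in the hyperplane at infinity; $\Delta$ is obtained by adding the inequality $p_1(y)>0$, which gives at most one new facet $\phi^1$ (on $p_1=0$). $\Phi_j(\overline{\Delta})$ is the number of $j$-dimensional faces of $\overline{\Delta}$; $\Phi_j^{\ell}(\overline{\Delta})$ is the number of $j$-dimensional faces whose affine span contains the origin (linear faces); $\Phi_j^{n\ell}(\overline{\Delta})$ is the number of $j$-dimensional faces lying on $\phi^\infty$ or $\phi^1$. *)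

theory Defs
  imports "HOL-Analysis.Analysis" "HOL-Library.Poly_Mapping"
begin

section \<open>Polynomials with real exponents on the positive orthant\<close>

definition pos_orthant :: "(real^'n) set" where
  "pos_orthant = {z. \<forall>i. 0 < z $ i}"

definition monom_at :: "real^'n \<Rightarrow> real^'n \<Rightarrow> real" where
  "monom_at w z = (\<Prod>i\<in>UNIV. z $ i powr w $ i)"

text \<open>A real linear combination of monomials is its finitely supported coefficient function; its
  monomials (with nonzero coefficient) are its keys.\<close>

type_synonym 'n rpoly = "(real^'n) \<Rightarrow>\<^sub>0 real"

definition rp_eval :: "'n::finite rpoly \<Rightarrow> real^'n \<Rightarrow> real" where
  "rp_eval f z = (\<Sum>w\<in>Poly_Mapping.keys f. Poly_Mapping.lookup f w * monom_at w z)"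

definition zero_set :: "'n::finite rpoly \<Rightarrow> (real^'n) set" where
  "zero_set f = {z \<in> pos_orthant. rp_eval f z = 0}"

definition smooth_zero_set :: "'n::finite rpoly \<Rightarrow> bool" where
  "smooth_zero_set f \<longleftrightarrow> (\<forall>z\<in>zero_set f. \<not> (rp_eval f has_derivative (\<lambda>h. 0)) (at z))"

definition compact_components :: "'n::finite rpoly \<Rightarrow> (real^'n) set set" where
  "compact_components f = {C \<in> components (zero_set f). compact C}"

definition partial_deriv :: "'n::finite \<Rightarrow> 'n rpoly \<Rightarrow> real^'n \<Rightarrow> real" where
  "partial_deriv i f z = frechet_derivative (rp_eval f) (at z) (axis i 1)"


section \<open>The normal form and the polyhedron\<close>

text \<open>\<open>e0 + (\<Sum>i. e\<^sub>i z\<^sub>i) + (\<Sum>j. c\<^sub>j z\<^bsup>a\<^sub>j\<^esup>)\<close>\<close>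

definition normal_form ::
    "real \<Rightarrow> real^'n::finite \<Rightarrow> real^'k::finite \<Rightarrow> (real^'n)^'k \<Rightarrow> 'n rpoly" where
  "normal_form e0 e c a =
     Poly_Mapping.single 0 e0
     + (\<Sum>i\<in>UNIV. Poly_Mapping.single (axis i 1) (e $ i))
     + (\<Sum>j\<in>UNIV. Poly_Mapping.single (a $ j) (c $ j))"

text \<open>The analytic changes of variables that bring a polynomial into normal form: the real analytic
  automorphism \<open>x \<mapsto> (t\<^sub>i x\<^bsup>B\<^sub>i\<^esup>)\<^sub>i\<close> of the orthant (\<open>B\<^sub>i\<close> the rows of an invertible real matrix),
  combined with multiplication by a positive multiple of a monomial.\<close>

definition monomial_equivalent :: "'n::finite rpoly \<Rightarrow> 'n rpoly \<Rightarrow> bool" where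
  "monomial_equivalent f g \<longleftrightarrow>
     (\<exists>(B::real^'n^'n) (t::real^'n) (w::real^'n) (r::real).
        invertible B \<and> t \<in> pos_orthant \<and> 0 < r \<and>
        (\<forall>x\<in>pos_orthant.
           rp_eval f x = r * monom_at w x * rp_eval g (\<chi> i. t $ i * monom_at (B $ i) x)))"

definition is_normal_form_of ::
    "'n::finite rpoly \<Rightarrow> real \<Rightarrow> real^'n \<Rightarrow> real^'k::finite \<Rightarrow> (real^'n)^'k \<Rightarrow> bool" where
  "is_normal_form_of f e0 e c a \<longleftrightarrow>
     e0 \<in> {-1, 1} \<and> (\<forall>i. e $ i \<in> {-1, 1}) \<and> (\<forall>j. c $ j \<noteq> 0) \<and>
     monomial_equivalent f (normal_form e0 e c a)"

text \<open>The index \<open>i1\<close> singles out the coordinate \<open>z\<^sub>1\<close>. The equations \<open>z\<^sub>i \<partial>f/\<partial>z\<^sub>i = 0\<close> for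
  \<open>i \<noteq> i1\<close> read \<open>e\<^sub>i z\<^sub>i + (\<Sum>j. c\<^sub>j a\<^sub>j\<^sub>i y\<^sub>j) = 0\<close> with \<open>y\<^sub>j = z\<^bsup>a\<^sub>j\<^esup>\<close>, and \<open>e\<^sub>i\<close> is its own inverse;
  \<open>z\<^sub>1\<close> is then obtained from \<open>f = 0\<close> by substitution. See \<open>critical_system_iff\<close> below.\<close>

definition crit_lin ::
    "real^'n::finite \<Rightarrow> real^'k::finite \<Rightarrow> (real^'n)^'k \<Rightarrow> 'n \<Rightarrow> real^'k \<Rightarrow> real" where
  "crit_lin e c a i y = - e $ i * (\<Sum>j\<in>UNIV. c $ j * a $ j $ i * y $ j)"

definition crit_form ::
    "'n \<Rightarrow> real \<Rightarrow> real^'n::finite \<Rightarrow> real^'k::finite \<Rightarrow> (real^'n)^'k \<Rightarrow> 'n \<Rightarrow> real^'k \<Rightarrow> real" where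
  "crit_form i1 e0 e c a i y =
     (if i = i1
      then - e $ i1 * (e0 + (\<Sum>l\<in>UNIV - {i1}. e $ l * crit_lin e c a l y)
                          + (\<Sum>j\<in>UNIV. c $ j * y $ j))
      else crit_lin e c a i y)"

definition Delta ::
    "'n \<Rightarrow> real \<Rightarrow> real^'n::finite \<Rightarrow> real^'k::finite \<Rightarrow> (real^'n)^'k \<Rightarrow> (real^'k) set" where
  "Delta i1 e0 e c a = {y \<in> pos_orthant. \<forall>i. 0 < crit_form i1 e0 e c a i y}"

definition Delta_cone ::
    "'n \<Rightarrow> real \<Rightarrow> real^'n::finite \<Rightarrow> real^'k::finite \<Rightarrow> (real^'n)^'k \<Rightarrow> (real^'k) set" where
  "Delta_cone i1 e0 e c a = {y \<in> pos_orthant. \<forall>i. i \<noteq> i1 \<longrightarrow> 0 < crit_form i1 e0 e c a i y}"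


section \<open>Real projective space\<close>

text \<open>Points of the projective space of a Euclidean space are its one-dimensional linear subspaces;
  the topology is the quotient topology from the nonzero vectors.\<close>

definition proj_points :: "'a::euclidean_space set set" where
  "proj_points = {L. subspace L \<and> dim L = 1}"

definition proj_topology :: "'a::euclidean_space set topology" where
  "proj_topology = topology (\<lambda>U. U \<subseteq> proj_points \<and> open {x. x \<noteq> 0 \<and> span {x} \<in> U})"

text \<open>Affine space is embedded as the vectors with first coordinate 1.\<close>

definition proj_embed :: "'a::euclidean_space \<Rightarrow> (real \<times> 'a) set" where
  "proj_embed y = span {(1, y)}"

definition proj_closure :: "'a::euclidean_space set \<Rightarrow> (real \<times> 'a) set set" where
  "proj_closure S = proj_topology closure_of (proj_embed ` S)"

definition hyperplane_at_infinity :: "(real \<times> 'a::euclidean_space) set set" where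
  "hyperplane_at_infinity = {L \<in> proj_points. \<forall>x\<in>L. fst x = 0}"

text \<open>\<open>T\<close> is a polytope in an affine chart (the complement of some projective hyperplane,
  identified with an affine hyperplane of vectors not through 0) and \<open>S\<close> is the corresponding
  set of projective points. The projective images of the faces of \<open>T\<close> do not depend
  on the chart.\<close>

definition chart_polytope :: "'a::euclidean_space set set \<Rightarrow> 'a set \<Rightarrow> bool" where
  "chart_polytope S T \<longleftrightarrow>
     polytope T \<and> (\<exists>u. \<forall>x\<in>T. u \<bullet> x = 1) \<and> S = (\<lambda>x. span {x}) ` T"

definition proj_polygon :: "'a::euclidean_space set set \<Rightarrow> bool" where
  "proj_polygon S \<longleftrightarrow> (\<exists>T. chart_polytope S T \<and> aff_dim T = 2)"

definition proj_faces :: "nat \<Rightarrow> 'a::euclidean_space set set \<Rightarrow> 'a set set set" where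
  "proj_faces j S =
     {(\<lambda>x. span {x}) ` F | F T. chart_polytope S T \<and> F face_of T \<and> aff_dim F = int j}"


section \<open>Faces of the closure of the polyhedron\<close>

text \<open>The projective span of a set \<open>F\<close> of points is the set of points in the linear span of their
  union. The projective closure of the affine span of a face not at infinity is the projective
  span of that face, and the projective span of a face at infinity misses the origin.\<close>

definition linear_faces :: "nat \<Rightarrow> (real \<times> 'a::euclidean_space) set set \<Rightarrow> (real \<times> 'a) set set set" where
  "linear_faces j S = {F \<in> proj_faces j S. proj_embed 0 \<subseteq> span (\<Union>F)}"

definition phi_infinity ::
    "'n \<Rightarrow> real \<Rightarrow> real^'n::finite \<Rightarrow> real^'k::finite \<Rightarrow> (real^'n)^'k \<Rightarrow> (real \<times> (real^'k)) set set" where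
  "phi_infinity i1 e0 e c a = proj_closure (Delta_cone i1 e0 e c a) \<inter> hyperplane_at_infinity"

definition phi_one ::
    "'n \<Rightarrow> real \<Rightarrow> real^'n::finite \<Rightarrow> real^'k::finite \<Rightarrow> (real^'n)^'k \<Rightarrow> (real \<times> (real^'k)) set set" where
  "phi_one i1 e0 e c a =
     proj_closure (Delta i1 e0 e c a) \<inter> proj_closure {y. crit_form i1 e0 e c a i1 y = 0}"

definition nonlinear_faces ::
    "nat \<Rightarrow> 'n \<Rightarrow> real \<Rightarrow> real^'n::finite \<Rightarrow> real^'k::finite \<Rightarrow> (real^'n)^'k
       \<Rightarrow> (real \<times> (real^'k)) set set set" where
  "nonlinear_faces j i1 e0 e c a =
     {F \<in> proj_faces j (proj_closure (Delta i1 e0 e c a)).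
        F \<subseteq> phi_infinity i1 e0 e c a \<or> F \<subseteq> phi_one i1 e0 e c a}"


section \<open>Basic facts\<close>

lemma openin_proj_topology:
  "openin proj_topology U \<longleftrightarrow> U \<subseteq> proj_points \<and> open {x. x \<noteq> 0 \<and> span {x} \<in> U}"
proof -
  let ?P = "\<lambda>U. U \<subseteq> proj_points \<and> open {x::'a. x \<noteq> 0 \<and> span {x} \<in> U}"
  have "istopology ?P"
    unfolding istopology_def
  proof (intro conjI allI impI)
    fix S T :: "'a set set" assume S: "?P S" and T: "?P T"
    have eq: "{x. x \<noteq> 0 \<and> span {x} \<in> S \<inter> T} = {x. x \<noteq> 0 \<and> span {x} \<in> S} \<inter> {x. x \<noteq> 0 \<and> span {x} \<in> T}"
      by auto
    show "open {x. x \<noteq> 0 \<and> span {x} \<in> S \<inter> T}"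
      unfolding eq using S T by (blast intro: open_Int)
    show "S \<inter> T \<subseteq> proj_points" using S by blast
  next
    fix K :: "'a set set set" assume K: "\<forall>S\<in>K. ?P S"
    have eq: "{x. x \<noteq> 0 \<and> span {x} \<in> \<Union>K} = (\<Union>S\<in>K. {x. x \<noteq> 0 \<and> span {x} \<in> S})"
      by auto
    show "open {x. x \<noteq> 0 \<and> span {x} \<in> \<Union>K}"
      unfolding eq using K by blast
    show "\<Union>K \<subseteq> proj_points" using K by blast
  qed
  then show ?thesis
    unfolding proj_topology_def by simp
qed

lemma topspace_proj_topology: "topspace proj_topology = (proj_points :: 'a::euclidean_space set set)"
proof -
  have "{x::'a. x \<noteq> 0 \<and> span {x} \<in> proj_points} = - {0}"
    by (auto simp: proj_points_def)
  then have "openin proj_topology (proj_points :: 'a set set)"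
    by (simp add: openin_proj_topology open_Compl)
  then show ?thesis
    by (meson openin_proj_topology openin_subset openin_topspace subset_antisym)
qed

lemma keys_sum_superset:
  fixes f :: "'n::finite rpoly"
  assumes "finite S" "Poly_Mapping.keys f \<subseteq> S"
  shows "(\<Sum>w\<in>Poly_Mapping.keys f. Poly_Mapping.lookup f w * m w) = (\<Sum>w\<in>S. Poly_Mapping.lookup f w * m w)"
  using assms by (intro sum.mono_neutral_left) (auto simp: in_keys_iff)

lemma keys_sum_add:
  fixes f g :: "'n::finite rpoly"
  shows "(\<Sum>w\<in>Poly_Mapping.keys (f + g). Poly_Mapping.lookup (f + g) w * m w) =
    (\<Sum>w\<in>Poly_Mapping.keys f. Poly_Mapping.lookup f w * m w) + (\<Sum>w\<in>Poly_Mapping.keys g. Poly_Mapping.lookup g w * m w)"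
proof -
  let ?S = "Poly_Mapping.keys f \<union> Poly_Mapping.keys g"
  have "(\<Sum>w\<in>Poly_Mapping.keys (f + g). Poly_Mapping.lookup (f + g) w * m w) = (\<Sum>w\<in>?S. Poly_Mapping.lookup (f + g) w * m w)"
    by (intro keys_sum_superset) (auto dest: subsetD[OF Poly_Mapping.keys_add])
  also have "\<dots> = (\<Sum>w\<in>?S. Poly_Mapping.lookup f w * m w) + (\<Sum>w\<in>?S. Poly_Mapping.lookup g w * m w)"
    by (simp add: lookup_add distrib_right sum.distrib)
  finally show ?thesis
    using keys_sum_superset[of ?S f m] keys_sum_superset[of ?S g m] by simp
qed

lemma keys_sum_sum:
  fixes g :: "'i \<Rightarrow> 'n::finite rpoly"
  assumes "finite I"
  shows "(\<Sum>w\<in>Poly_Mapping.keys (\<Sum>i\<in>I. g i). Poly_Mapping.lookup (\<Sum>i\<in>I. g i) w * m w) =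
    (\<Sum>i\<in>I. \<Sum>w\<in>Poly_Mapping.keys (g i). Poly_Mapping.lookup (g i) w * m w)"
  using assms by induction (simp_all add: keys_sum_add)

lemma keys_sum_single:
  fixes w :: "real^'n::finite" and r :: real
  shows "(\<Sum>v\<in>Poly_Mapping.keys (Poly_Mapping.single w r). Poly_Mapping.lookup (Poly_Mapping.single w r) v * m v) = r * m w"
  using keys_sum_superset[of "{w}" "Poly_Mapping.single w r" m] by simp

lemma keys_sum_normal_form:
  "(\<Sum>w\<in>Poly_Mapping.keys (normal_form e0 e c a). Poly_Mapping.lookup (normal_form e0 e c a) w * m w) =
    e0 * m 0 + (\<Sum>i\<in>UNIV. e $ i * m (axis i 1)) + (\<Sum>j\<in>UNIV. c $ j * m (a $ j))"
  by (simp only: normal_form_def keys_sum_add keys_sum_sum[OF finite] keys_sum_single)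

lemma pos_orthantD: "z \<in> pos_orthant \<Longrightarrow> 0 < z $ i"
  by (simp add: pos_orthant_def)

lemma monom_at_axis:
  assumes "z \<in> pos_orthant" shows "monom_at (axis i 1) z = z $ i"
proof -
  have "monom_at (axis i 1) z = (\<Prod>l\<in>UNIV. if l = i then z $ l else 1)"
    unfolding monom_at_def using pos_orthantD[OF assms]
    by (intro prod.cong) (auto simp: axis_def less_imp_le less_imp_neq[symmetric])
  then show ?thesis by simp
qed

lemma monom_at_0:
  assumes "z \<in> pos_orthant" shows "monom_at 0 z = 1"
  using pos_orthantD[OF assms] by (simp add: monom_at_def less_imp_neq[symmetric])

lemma rp_eval_normal_form:
  assumes "z \<in> pos_orthant"
  shows "rp_eval (normal_form e0 e c a) z =
    e0 + (\<Sum>i\<in>UNIV. e $ i * z $ i) + (\<Sum>j\<in>UNIV. c $ j * monom_at (a $ j) z)"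
  using assms
  by (simp add: rp_eval_def keys_sum_normal_form monom_at_0 monom_at_axis)

lemma open_pos_orthant: "open (pos_orthant :: (real^'n::finite) set)"
proof -
  have eq: "pos_orthant = (\<Inter>i. {z::real^'n. 0 < z $ i})"
    by (auto simp: pos_orthant_def)
  show ?thesis
    unfolding eq by (intro open_INT finite ballI open_Collect_less continuous_intros)
qed

lemma monom_at_has_derivative:
  assumes z: "z \<in> pos_orthant"
  shows "(monom_at w has_derivative (\<lambda>h. monom_at w z * (\<Sum>i\<in>UNIV. w $ i * h $ i / z $ i))) (at z)"
proof -
  have ev: "\<forall>\<^sub>F x in nhds z. exp (\<Sum>i\<in>UNIV. w $ i * ln (x $ i)) = monom_at w x"
    using eventually_nhds_in_open[OF open_pos_orthant z]
  proof eventually_elim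
    case (elim x)
    then have "\<And>i. x $ i > 0" by (simp add: pos_orthant_def)
    then show ?case
      by (simp add: monom_at_def exp_sum powr_def less_imp_neq[symmetric])
  qed
  have pos: "\<And>i. z $ i > 0" using z by (simp add: pos_orthant_def)
  have "((\<lambda>x. w $ i * ln (x $ i)) has_derivative (\<lambda>h. w $ i * (h $ i * inverse (z $ i)))) (at z)" for i
    by (intro has_derivative_mult_right has_derivative_ln pos
        bounded_linear_imp_has_derivative bounded_linear_vec_nth)
  then have "((\<lambda>x. exp (\<Sum>i\<in>UNIV. w $ i * ln (x $ i))) has_derivative
      (\<lambda>h. (\<Sum>i\<in>UNIV. w $ i * (h $ i * inverse (z $ i)))
        * exp (\<Sum>i\<in>UNIV. w $ i * ln (z $ i)))) (at z)"
    by (intro has_derivative_exp has_derivative_sum)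
  then have "((\<lambda>x. exp (\<Sum>i\<in>UNIV. w $ i * ln (x $ i))) has_derivative
      (\<lambda>h. monom_at w z * (\<Sum>i\<in>UNIV. w $ i * h $ i / z $ i))) (at z)"
    by (simp only: eventually_nhds_x_imp_x[OF ev] divide_inverse mult.assoc
        mult.commute[of _ "monom_at w z"])
  then show ?thesis
    by (rule has_derivative_transform_eventually)
       (use ev eventually_nhds_x_imp_x[OF ev] in \<open>auto simp: eventually_at_filter elim: eventually_mono\<close>)
qed

lemma partial_deriv_eq:
  assumes z: "z \<in> pos_orthant"
  shows "z $ i * partial_deriv i f z = (\<Sum>w\<in>Poly_Mapping.keys f. Poly_Mapping.lookup f w * w $ i * monom_at w z)"
proof -
  have pos: "z $ i > 0" using z by (simp add: pos_orthant_def)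
  have "(rp_eval f has_derivative
      (\<lambda>h. \<Sum>w\<in>Poly_Mapping.keys f. Poly_Mapping.lookup f w * (monom_at w z * (\<Sum>i\<in>UNIV. w $ i * h $ i / z $ i)))) (at z)"
    unfolding rp_eval_def[abs_def]
    by (intro has_derivative_sum has_derivative_mult_right monom_at_has_derivative z)
  from frechet_derivative_at[OF this, symmetric] have "partial_deriv i f z =
      (\<Sum>w\<in>Poly_Mapping.keys f. Poly_Mapping.lookup f w * (monom_at w z * (\<Sum>l\<in>UNIV. w $ l * axis i 1 $ l / z $ l)))"
    by (simp add: partial_deriv_def)
  also have "\<dots> = (\<Sum>w\<in>Poly_Mapping.keys f. Poly_Mapping.lookup f w * (monom_at w z * (w $ i / z $ i)))"
    by (simp add: axis_def if_distrib[of "\<lambda>t. _ * t / _"] cong: if_cong)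
  finally show ?thesis
    using pos by (simp add: sum_distrib_left)
       (intro sum.cong, auto simp: field_simps)
qed

lemma partial_deriv_normal_form:
  assumes z: "z \<in> pos_orthant"
  shows "z $ i * partial_deriv i (normal_form e0 e c a) z =
    e $ i * z $ i + (\<Sum>j\<in>UNIV. c $ j * a $ j $ i * monom_at (a $ j) z)"
proof -
  have "z $ i * partial_deriv i (normal_form e0 e c a) z =
      (\<Sum>l\<in>UNIV. e $ l * (axis l 1 $ i * monom_at (axis l 1) z))
      + (\<Sum>j\<in>UNIV. c $ j * (a $ j $ i * monom_at (a $ j) z))"
    using keys_sum_normal_form[of e0 e c a "\<lambda>w. w $ i * monom_at w z"]
    by (simp add: partial_deriv_eq[OF z] mult.assoc)
  also have "(\<Sum>l\<in>UNIV. e $ l * (axis l 1 $ i * monom_at (axis l 1) z)) =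
      (\<Sum>l\<in>UNIV. if l = i then e $ i * z $ i else 0)"
    by (intro sum.cong) (auto simp: axis_def monom_at_axis[OF z, unfolded axis_def])
  finally show ?thesis by (simp add: mult.assoc)
qed

text \<open>\<^const>\<open>crit_form\<close> is the solution of the system for the critical points of \<open>z\<^sub>1\<close> on the zero set.\<close>

lemma critical_system_iff:
  fixes e z :: "real^'n::finite" and c :: "real^'k::finite"
  assumes z: "z \<in> pos_orthant" and e: "\<And>i. e $ i \<in> {-1, 1}"
  shows "rp_eval (normal_form e0 e c a) z = 0 \<and>
      (\<forall>i. i \<noteq> i1 \<longrightarrow> z $ i * partial_deriv i (normal_form e0 e c a) z = 0)
    \<longleftrightarrow> (\<forall>i. z $ i = crit_form i1 e0 e c a i (\<chi> j. monom_at (a $ j) z))"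
proof -
  define y where "y = (\<chi> j. monom_at (a $ j) z)"
  have unit: "e $ i * t + s = 0 \<longleftrightarrow> t = - e $ i * s" for i t s
    using e[of i] by auto
  have lin: "z $ i * partial_deriv i (normal_form e0 e c a) z = 0 \<longleftrightarrow> z $ i = crit_lin e c a i y" for i
    by (simp only: partial_deriv_normal_form[OF z] crit_lin_def y_def unit vec_lambda_beta)
  have f: "rp_eval (normal_form e0 e c a) z = 0 \<longleftrightarrow>
      z $ i1 = - e $ i1 * (e0 + (\<Sum>l\<in>UNIV - {i1}. e $ l * z $ l) + (\<Sum>j\<in>UNIV. c $ j * y $ j))"
  proof -
    have "rp_eval (normal_form e0 e c a) z =
        e $ i1 * z $ i1 + (e0 + (\<Sum>l\<in>UNIV - {i1}. e $ l * z $ l) + (\<Sum>j\<in>UNIV. c $ j * y $ j))"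
      by (simp add: rp_eval_normal_form[OF z] y_def sum.remove[of UNIV i1])
    then show ?thesis by (simp only: unit)
  qed
  have sub: "(\<Sum>l\<in>UNIV - {i1}. e $ l * z $ l) = (\<Sum>l\<in>UNIV - {i1}. e $ l * crit_lin e c a l y)"
    if "\<And>i. i \<noteq> i1 \<Longrightarrow> z $ i = crit_lin e c a i y"
    using that by (intro sum.cong) auto
  show ?thesis
    unfolding y_def[symmetric] f lin crit_form_def using sub by (metis (no_types, lifting))
qed

end

theory Submission
  imports Defs "HOL-Complex_Analysis.Conformal_Mappings"
begin

text \<open>
  The polygon and the components are treated by separate arguments.

  \<^bold>\<open>The polygon.\<close> Homogenised in \<open>\<real> \<times> \<real>\<^sup>2\<close>, the closure of \<open>\<Delta>\<close> becomes a closed convex cone. The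
  homogeneous inequalities \<open>y\<^sub>j > 0\<close> and \<open>p\<^sub>i > 0\<close>, \<open>i \<noteq> 1\<close>, together describe a sector of the plane,
  and a sector has only two sides whatever the number of inequalities (\<open>plane_cone_two_sides\<close>). With
  the line at infinity and the line \<open>p\<^sub>1 = 0\<close> this makes four walls. Those of the sector pass through
  the origin; the other two do not, because the constant term of \<open>p\<^sub>1\<close> is \<open>\<plusminus>1\<close>. This bounds the
  linear and the nonlinear sides. A polygon with four walls has at most four vertices, since each
  vertex lies on two walls and each wall carries at most two vertices
  (\<open>plane_polygon.card_extreme_points\<close>). Faces are defined through arbitrary affine charts, and
  \<open>proj_faces_in_chart\<close> reduces them to a single one.

  \<^bold>\<open>The components.\<close> On a compact component of the zero set, a function \<open>\<xi> \<bullet> ln z\<close> has a maximum and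
  a minimum, so a bound for its critical points on the zero set, divided by two, bounds the number of
  components. The direction \<open>\<xi>\<close> is chosen to suit the exponents: \<open>n + 1\<close> of them form an affine basis
  \<open>U\<close>, and \<open>\<xi> = w\<^sub>1 - w\<^sub>0\<close> is the difference of the other two. By Lagrange, at a critical point the
  terms \<open>c\<^sub>u z\<^bsup>u\<^esup>\<close>, \<open>u \<in> U\<close>, are fixed linear forms in two unknowns. Dividing by one of the monomials
  leaves one real parameter \<open>t\<close>, the other \<open>n\<close> monomials are affine functions \<open>q\<^sub>u(t)\<close>, and what
  remains of the critical point equations is a single equation
  \<open>m(t) = d\<^sub>0 \<Prod> q\<^sub>u(t)\<^bsup>\<mu>\<^sub>0(u)\<^esup> + d\<^sub>1 \<Prod> q\<^sub>u(t)\<^bsup>\<mu>\<^sub>1(u)\<^esup>\<close> with \<open>m\<close> affine, on the interval where all \<open>q\<^sub>u\<close> are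
  positive (\<open>two_extra_exponents.critical_realises\<close>). Two applications of Rolle's theorem bound the
  number of its solutions by \<open>5n - 2\<close> (\<open>affine_forms.three_term_zeros\<close>) unless it holds identically.

  In the identical case the critical points form one connected curve, parametrised by the interval.
  A compact component contains a critical point, hence the whole curve, and then compactness keeps
  every \<open>q\<^sub>u\<close> away from 0 on the interval. The interval is then open and closed, hence the whole line,
  on which a nonconstant affine function cannot stay positive. So there are no compact components.
\<close>


section \<open>Zeros of sums of two power products and an affine function\<close>

text \<open>The form in which Rolle's theorem is used for counting: \<open>Z\<close> are zeros of a function and \<open>S\<close> collects
the zeros of its derivative and its poles. Counting the elements of \<open>S\<close> below a point is injective on \<open>Z\<close>.\<close>

lemma card_le_card_separators:
  fixes Z S :: "real set"
  assumes "finite S" and sep: "\<And>x y. x \<in> Z \<Longrightarrow> y \<in> Z \<Longrightarrow> x < y \<Longrightarrow> \<exists>r\<in>S. x < r \<and> r < y"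
  shows "finite Z \<and> card Z \<le> card S + 1"
proof -
  define k where "k x = card {r \<in> S. r < x}" for x :: real
  have less: "k x < k y" if xy: "x \<in> Z" "y \<in> Z" "x < y" for x y
  proof -
    obtain r where "r \<in> S" "x < r" "r < y" using sep[OF xy] by blast
    then have "r \<in> {r \<in> S. r < y}" "r \<notin> {r \<in> S. r < x}" by auto
    moreover have "{r \<in> S. r < x} \<subseteq> {r \<in> S. r < y}"
      using xy(3) by (simp add: Collect_mono_iff)
    ultimately have "{r \<in> S. r < x} \<subset> {r \<in> S. r < y}" by blast
    moreover have "finite {r \<in> S. r < y}" using \<open>finite S\<close> by simp
    ultimately show ?thesis unfolding k_def by (rule psubset_card_mono[rotated])
  qed
  have inj: "inj_on k Z"
  proof (rule linorder_inj_onI')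
    fix x y assume "x \<in> Z" "y \<in> Z" "x < y"
    then show "k x \<noteq> k y" using less[of x y] by simp
  qed
  have sub: "k ` Z \<subseteq> {..card S}"
    using card_mono[OF \<open>finite S\<close>, of "{r \<in> S. r < _}"] by (auto simp: k_def)
  show ?thesis
    using inj_on_finite[OF inj sub] card_inj_on_le[OF inj sub] by simp
qed

lemma Rolle_real:
  fixes f f' :: "real \<Rightarrow> real"
  assumes "a < b" "f a = f b" and der: "\<And>x. a \<le> x \<Longrightarrow> x \<le> b \<Longrightarrow> (f has_real_derivative f' x) (at x)"
  shows "\<exists>z. a < z \<and> z < b \<and> f' z = 0"
proof -
  have "continuous_on {a..b} f"
    by (metis DERIV_isCont atLeastAtMost_iff continuous_at_imp_continuous_on der)
  then obtain z where "a < z" "z < b" "(f has_real_derivative 0) (at z)"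
    using Rolle[OF assms(1,2)] der real_differentiable_def less_imp_le by metis
  then show ?thesis using der DERIV_unique by (metis less_imp_le)
qed

text \<open>A finite family of affine functions of one variable, considered on the interval where all of them are
positive. A product of real powers of the forms satisfies \<open>H' / H = dlog_poly / forms_poly\<close>, a quotient of
polynomials, so derivatives of such products are the products themselves times rational functions.\<close>

locale affine_forms =
  fixes J :: "'j set" and \<alpha> \<beta> :: "'j \<Rightarrow> real"
  assumes finite_J: "finite J" and J_nonempty: "J \<noteq> {}"
begin

definition form :: "'j \<Rightarrow> real \<Rightarrow> real" where
  "form j t = \<alpha> j + \<beta> j * t"

definition region :: "real set" where
  "region = {t. \<forall>j\<in>J. 0 < form j t}"

definition power_product :: "('j \<Rightarrow> real) \<Rightarrow> real \<Rightarrow> real" where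
  "power_product \<gamma> t = exp (\<Sum>j\<in>J. \<gamma> j * ln (form j t))"

definition forms_poly :: "real poly" where
  "forms_poly = (\<Prod>j\<in>J. [:\<alpha> j, \<beta> j:])"

definition dlog_poly :: "('j \<Rightarrow> real) \<Rightarrow> real poly" where
  "dlog_poly \<gamma> = (\<Sum>j\<in>J. smult (\<gamma> j * \<beta> j) (\<Prod>i\<in>J - {j}. [:\<alpha> i, \<beta> i:]))"

lemma open_region: "open region"
proof -
  have eq: "region = (\<Inter>j\<in>J. {t. 0 < form j t})" by (auto simp: region_def)
  show ?thesis
    unfolding eq form_def using finite_J by (intro open_INT ballI open_Collect_less continuous_intros)
qed

lemma convex_region: "convex region"
proof -
  have eq: "region = (\<Inter>j\<in>J. {t. 0 < form j t})" by (auto simp: region_def)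
  have "convex {t. 0 < form j t}" for j
  proof (rule convexI)
    fix x y u v :: real assume "x \<in> {t. 0 < form j t}" "y \<in> {t. 0 < form j t}" "0 \<le> u" "0 \<le> v" "u + v = 1"
    moreover from this have "form j (u *\<^sub>R x + v *\<^sub>R y) = u * form j x + v * form j y"
    proof -
      have "\<alpha> j = (u + v) * \<alpha> j" using \<open>u + v = 1\<close> by simp
      then show ?thesis by (simp add: form_def algebra_simps)
    qed
    ultimately show "u *\<^sub>R x + v *\<^sub>R y \<in> {t. 0 < form j t}"
      by (metis (mono_tags, lifting) add_nonneg_pos add_pos_nonneg le_less mem_Collect_eq
          mult_nonneg_nonneg mult_pos_pos zero_less_one add_0)
  qed
  then show ?thesis unfolding eq by (intro convex_INT)
qed

lemma region_interval:
  assumes "x \<in> region" "y \<in> region" "x \<le> s" "s \<le> y"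
  shows "s \<in> region"
proof -
  have "closed_segment x y \<subseteq> region"
    using convex_region assms by (simp add: convex_contains_segment)
  then show ?thesis using assms by (auto simp: closed_segment_eq_real_ivl)
qed

lemma power_product_pos: "0 < power_product \<gamma> t"
  by (simp add: power_product_def)

lemma poly_forms_poly: "poly forms_poly t = (\<Prod>j\<in>J. form j t)"
  by (simp add: forms_poly_def form_def poly_prod mult.commute)

lemma forms_poly_pos: "t \<in> region \<Longrightarrow> 0 < poly forms_poly t"
  unfolding poly_forms_poly by (intro prod_pos) (auto simp: region_def)

lemma degree_forms_le: "degree (\<Prod>j\<in>A. [:\<alpha> j, \<beta> j:]) \<le> card A"
proof (cases "finite A")
  case True
  have "degree (\<Prod>j\<in>A. [:\<alpha> j, \<beta> j:]) \<le> (\<Sum>j\<in>A. degree [:\<alpha> j, \<beta> j:])"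
    using degree_prod_sum_le[OF True, of "\<lambda>j. [:\<alpha> j, \<beta> j:]"] unfolding o_def .
  also have "\<dots> \<le> (\<Sum>j\<in>A. 1)" by (intro sum_mono) simp
  finally show ?thesis by simp
qed simp

lemma degree_forms_poly: "degree forms_poly \<le> card J"
  unfolding forms_poly_def by (rule degree_forms_le)

lemma degree_dlog_poly: "degree (dlog_poly \<gamma>) \<le> card J - 1"
  unfolding dlog_poly_def
proof (intro degree_sum_le finite_J)
  fix j assume "j \<in> J"
  then show "degree (smult (\<gamma> j * \<beta> j) (\<Prod>i\<in>J - {j}. [:\<alpha> i, \<beta> i:])) \<le> card J - 1"
    using degree_forms_le[of "J - {j}"] finite_J
    by (intro order_trans[OF degree_smult_le]) simp
qed

lemma power_product_diff:
  "power_product (\<lambda>j. \<mu> j - \<nu> j) t = power_product \<mu> t / power_product \<nu> t"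
  by (simp add: power_product_def exp_diff[symmetric] sum_subtractf left_diff_distrib)

lemma power_product_derivative:
  assumes t: "t \<in> region"
  shows "(power_product \<gamma> has_real_derivative
           power_product \<gamma> t * (poly (dlog_poly \<gamma>) t / poly forms_poly t)) (at t)"
proof -
  have pos: "0 < form j t" if "j \<in> J" for j using t that by (simp add: region_def)
  have "(form j has_real_derivative \<beta> j) (at t)" for j
    unfolding form_def[abs_def] by (auto intro!: derivative_eq_intros)
  then have "((\<lambda>t. \<Sum>j\<in>J. \<gamma> j * ln (form j t)) has_real_derivative
      (\<Sum>j\<in>J. \<gamma> j * (\<beta> j / form j t))) (at t)"
    using pos by (intro DERIV_sum) (auto intro!: derivative_eq_intros)
  then have D: "(power_product \<gamma> has_real_derivative
      power_product \<gamma> t * (\<Sum>j\<in>J. \<gamma> j * (\<beta> j / form j t))) (at t)"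
    unfolding power_product_def[abs_def] by (rule DERIV_fun_exp)
  have "poly (dlog_poly \<gamma>) t / poly forms_poly t = (\<Sum>j\<in>J. \<gamma> j * (\<beta> j / form j t))"
  proof -
    have "\<gamma> j * \<beta> j * (\<Prod>i\<in>J - {j}. form i t) / (\<Prod>i\<in>J. form i t) = \<gamma> j * (\<beta> j / form j t)"
      if "j \<in> J" for j
    proof -
      have nz: "(\<Prod>i\<in>J - {j}. form i t) \<noteq> 0" using finite_J pos
        by (metis DiffD1 less_numeral_extra(3) prod_pos)
      have "(\<Prod>i\<in>J. form i t) = form j t * (\<Prod>i\<in>J - {j}. form i t)"
        using prod.remove[OF finite_J that] by blast
      then show ?thesis using nz by simp
    qed
    then show ?thesis
      unfolding poly_forms_poly dlog_poly_def poly_sum sum_divide_distrib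
      by (intro sum.cong) (simp_all add: poly_prod form_def mult.commute)
  qed
  with D show ?thesis by simp
qed

text \<open>Analytic continuation. On the strip of complex numbers with real part in \<open>region\<close> the forms have
positive real part, so the principal logarithm extends the power product holomorphically there.\<close>

lemma two_term_identity:
  assumes xy: "x \<in> region" "y \<in> region" "x < y"
    and eq: "\<And>s. x < s \<Longrightarrow> s < y \<Longrightarrow> poly A s = power_product \<gamma> s * poly B s"
    and t: "t \<in> region"
  shows "poly A t = power_product \<gamma> t * poly B t"
proof -
  define strip where "strip = {z::complex. Re z \<in> region}"
  define cf where "cf j z = of_real (\<alpha> j) + of_real (\<beta> j) * z" for j and z :: complex
  define G where "G z = poly (map_poly of_real A) z
      - exp (\<Sum>j\<in>J. of_real (\<gamma> j) * Ln (cf j z)) * poly (map_poly of_real B) z" for z :: complex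
  have Re_cf: "Re (cf j z) = form j (Re z)" for j z by (simp add: cf_def form_def)
  have nonneg: "cf j z \<notin> \<real>\<^sub>\<le>\<^sub>0" if "z \<in> strip" "j \<in> J" for z j
    using that Re_cf[of j z] by (auto simp: strip_def region_def complex_nonpos_Reals_iff)
  have hol: "G holomorphic_on strip"
    unfolding G_def cf_def
    by (intro holomorphic_intros) (use nonneg in \<open>auto simp: cf_def\<close>)
  have real: "G (of_real s) = of_real (poly A s - power_product \<gamma> s * poly B s)" if "s \<in> region" for s
  proof -
    have "Ln (cf j (of_real s)) = of_real (ln (form j s))" if "j \<in> J" for j
    proof -
      have "0 < form j s" using that \<open>s \<in> region\<close> by (simp add: region_def)
      then have "Ln (of_real (form j s)) = of_real (ln (form j s))" by (rule Ln_of_real)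
      then show ?thesis by (simp add: cf_def form_def)
    qed
    then have "(\<Sum>j\<in>J. of_real (\<gamma> j) * Ln (cf j (of_real s)))
        = of_real (\<Sum>j\<in>J. \<gamma> j * ln (form j s))" by simp
    moreover have "poly (map_poly of_real p) (of_real s) = (of_real (poly p s) :: complex)" for p
      by (induction p) (simp_all add: map_poly_pCons)
    ultimately show ?thesis by (simp only: G_def power_product_def exp_of_real of_real_diff of_real_mult)
  qed
  have strip_eq: "strip = Re -` region" by (auto simp: strip_def)
  have "open strip" unfolding strip_eq by (intro open_vimage open_region continuous_intros)
  moreover have "connected strip"
    unfolding strip_eq
    by (intro convex_connected convex_linear_vimage convex_region) (simp add: bounded_linear_Re bounded_linear.linear)
  moreover have "(of_real ` {x<..<y} :: complex set) \<subseteq> strip"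
    using region_interval[OF xy(1,2)] by (auto simp: strip_def)
  moreover have "(of_real ((x + y) / 2) :: complex) islimpt of_real ` {x<..<y}"
  proof -
    have lp: "((x + y) / 2) islimpt {x<..<y}"
      using xy(3) by (intro interior_limit_point) (auto simp: field_simps)
    show ?thesis
      unfolding islimpt_approachable
    proof (intro allI impI)
      fix e :: real assume "e > 0"
      then obtain s where "s \<in> {x<..<y}" "s \<noteq> (x+y)/2" "dist s ((x+y)/2) < e"
        using lp unfolding islimpt_approachable by blast
      then show "\<exists>x'\<in>of_real ` {x<..<y}. x' \<noteq> (of_real ((x + y) / 2) :: complex) \<and> dist x' (of_real ((x + y) / 2)) < e"
        by (intro bexI[of _ "of_real s"]) (auto simp: dist_of_real simp del: of_real_divide of_real_add)
    qed
  qed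
  moreover have "of_real ((x + y) / 2) \<in> strip"
    using region_interval[OF xy(1,2), of "(x+y)/2"] xy(3) by (simp add: strip_def)
  moreover have "G z = 0" if z: "z \<in> of_real ` {x<..<y}" for z
  proof -
    obtain s where s: "z = of_real s" "x < s" "s < y" using z by auto
    then show ?thesis using real[of s] eq[of s] region_interval[OF xy(1,2), of s] by simp
  qed
  moreover have "of_real t \<in> strip" using t by (simp add: strip_def)
  ultimately have "G (of_real t) = 0"
    using analytic_continuation[OF hol] by blast
  then show ?thesis using real[OF t] by (metis eq_iff_diff_eq_0 of_real_eq_0_iff)
qed

lemma card_poly_zeros_le:
  assumes "(p :: real poly) \<noteq> 0" "degree p \<le> d"
  shows "finite {t \<in> X. poly p t = 0}" "card {t \<in> X. poly p t = 0} \<le> d"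
proof -
  have f: "finite {t. poly p t = 0}" using poly_roots_finite assms by blast
  then show "finite {t \<in> X. poly p t = 0}" by (rule rev_finite_subset) auto
  have "card {t \<in> X. poly p t = 0} \<le> card {t. poly p t = 0}"
    using f by (intro card_mono) auto
  also have "\<dots> \<le> degree p" using card_poly_roots_bound assms by blast
  finally show "card {t \<in> X. poly p t = 0} \<le> d" using assms by simp
qed

text \<open>Away from the zeros of \<open>B\<close>, zeros are places where \<open>A / (H B)\<close> equals 1, and the derivative of this
quotient is a polynomial \<open>N\<close> of degree at most \<open>3n - 2\<close> divided by \<open>Q H B\<^sup>2\<close>, where \<open>Q\<close> is the product of
the forms. The at most \<open>n - 1\<close> zeros of \<open>B\<close> enter twice: as zeros themselves and as poles that
separate zeros. If \<open>N = 0\<close>, two zeros with no pole between them make the quotient constant, which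
analytic continuation excludes.\<close>

lemma two_term_zeros:
  assumes A: "degree A \<le> card J" and B: "degree B \<le> card J - 1"
    and nz: "\<exists>t\<in>region. poly A t \<noteq> power_product \<gamma> t * poly B t"
  defines "Z \<equiv> {t \<in> region. poly A t = power_product \<gamma> t * poly B t}"
  shows "finite Z \<and> card Z \<le> 5 * card J - 3"
proof -
  define n where "n = card J"
  have n: "n \<ge> 1" using finite_J J_nonempty by (simp add: n_def Suc_le_eq card_gt_0_iff)
  show ?thesis
  proof (cases "B = 0")
    case True
    then have "A \<noteq> 0" using nz by auto
    then have "finite Z \<and> card Z \<le> n"
      using card_poly_zeros_le[of A n region] A True by (simp add: Z_def n_def)
    moreover have "n \<le> 5 * n - 3" using n by linarith
    ultimately show ?thesis unfolding n_def by linarith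
  next
    case False
    define N where "N = forms_poly * (pderiv A * B - A * pderiv B) - A * B * dlog_poly \<gamma>"
    define R where "R = {t \<in> region. poly B t = 0}"
    \<comment> \<open>the zero polynomial contributes no separators; that case is excluded by continuation\<close>
    define S where "S = (if N = 0 then {} else {t \<in> region. poly N t = 0})"
    define Z' where "Z' = Z - R"
    have R: "finite R" "card R \<le> n - 1"
      unfolding R_def using card_poly_zeros_le[OF False B] by (auto simp: n_def)
    have degN: "degree N \<le> 3 * n - 2"
    proof -
      have dA: "degree A \<le> n" and dB: "degree B \<le> n - 1" using A B by (auto simp: n_def)
      have dQ: "degree forms_poly \<le> n" and dS: "degree (dlog_poly \<gamma>) \<le> n - 1"
        using degree_forms_poly degree_dlog_poly by (auto simp: n_def)
      have "degree (pderiv A * B) \<le> 2 * n - 2"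
        using dA dB n degree_mult_le[of "pderiv A" B] by (simp add: degree_pderiv)
      moreover have "degree (A * pderiv B) \<le> 2 * n - 2"
      proof (cases "degree B = 0")
        case True
        then have "pderiv B = 0" by (simp add: pderiv_eq_0_iff)
        then show ?thesis by simp
      next
        case False
        then show ?thesis
          using dA dB n degree_mult_le[of A "pderiv B"] by (simp add: degree_pderiv)
      qed
      ultimately have "degree (pderiv A * B - A * pderiv B) \<le> 2 * n - 2"
        by (rule degree_diff_le)
      then have "degree (forms_poly * (pderiv A * B - A * pderiv B)) \<le> 3 * n - 2"
        using dQ n degree_mult_le[of forms_poly "pderiv A * B - A * pderiv B"] by linarith
      moreover have "degree (A * B * dlog_poly \<gamma>) \<le> 3 * n - 2"
        using dA dB dS n degree_mult_le[of "A * B" "dlog_poly \<gamma>"] degree_mult_le[of A B] by linarith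
      ultimately show ?thesis unfolding N_def by (rule degree_diff_le)
    qed
    have S: "finite S" "card S \<le> 3 * n - 2"
      unfolding S_def using card_poly_zeros_le[OF _ degN, of region] by auto
    have "\<exists>r\<in>R \<union> S. x < r \<and> r < y" if x: "x \<in> Z'" and y: "y \<in> Z'" and xy: "x < y" for x y
    proof (rule ccontr)
      assume none: "\<not> (\<exists>r\<in>R \<union> S. x < r \<and> r < y)"
      define f where "f t = poly A t / (power_product \<gamma> t * poly B t)" for t
      define f' where "f' t = poly N t / (poly forms_poly t * power_product \<gamma> t * (poly B t)\<^sup>2)" for t
      have xr: "x \<in> region" "y \<in> region" using x y by (auto simp: Z'_def Z_def)
      have reg: "s \<in> region" if "x \<le> s" "s \<le> y" for s using region_interval[OF xr] that by blast
      have Bnz: "poly B s \<noteq> 0" if "x \<le> s" "s \<le> y" for s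
      proof (cases "s = x \<or> s = y")
        case True then show ?thesis using x y xr by (auto simp: Z'_def R_def)
      next
        case False then show ?thesis using none that reg by (force simp: R_def)
      qed
      have ends: "f x = 1" "f y = 1"
        using x y Bnz[of x] Bnz[of y] power_product_pos[of \<gamma>] xy
        by (auto simp: f_def Z'_def Z_def less_imp_neq[symmetric])
      have der: "(f has_real_derivative f' s) (at s)" if s: "x \<le> s" "s \<le> y" for s
      proof -
        have H: "power_product \<gamma> s > 0" by (rule power_product_pos)
        have Q: "poly forms_poly s > 0" using forms_poly_pos reg s by blast
        have [derivative_intros]: "(power_product \<gamma> has_real_derivative
           power_product \<gamma> s * (poly (dlog_poly \<gamma>) s / poly forms_poly s)) (at s)"
          using power_product_derivative reg s by blast
        show ?thesis
          unfolding f_def f'_def N_def using H Q Bnz[OF s]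
          by (auto intro!: derivative_eq_intros poly_DERIV simp: field_simps power2_eq_square)
      qed
      show False
      proof (cases "N = 0")
        case True
        have const: "f s = 1" if s: "x < s" "s < y" for s
        proof -
          have "f s = f x"
            using s der True
            by (intro DERIV_isconst_end[of x s f])
               (auto intro!: continuous_at_imp_continuous_on DERIV_isCont[where D = "f' _"] simp: f'_def)
          then show ?thesis using ends by simp
        qed
        have "poly A s = power_product \<gamma> s * poly B s" if s: "x < s" "s < y" for s
          using const[OF s] Bnz[of s] s power_product_pos[of \<gamma> s] by (simp add: f_def field_simps)
        then show False using nz two_term_identity[OF xr xy, of A \<gamma> B] by blast
      next
        case False
        obtain s where s: "x < s" "s < y" "f' s = 0"
          using Rolle_real[OF xy, of f f'] ends der by auto
        then have "poly N s = 0"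
          using Bnz[of s] forms_poly_pos[OF reg, of s] power_product_pos[of \<gamma> s] by (auto simp: f'_def)
        then have "s \<in> S" using s reg False by (simp add: S_def)
        then show False using none s by blast
      qed
    qed
    then have Z': "finite Z'" "card Z' \<le> card (R \<union> S) + 1"
      using card_le_card_separators[of "R \<union> S" Z'] R S by blast+
    have "card (R \<union> S) \<le> (n - 1) + (3 * n - 2)" using card_Un_le[of R S] R S by linarith
    moreover have "card Z \<le> card Z' + card R"
      using card_Un_le[of Z' R] card_mono[of "Z' \<union> R" Z] Z' R by (force simp: Z'_def)
    moreover have "finite Z" using Z' R by (simp add: Z'_def)
    ultimately show ?thesis using Z' R n by (simp add: n_def)
  qed
qed

text \<open>Dividing \<open>h\<close> by the first power product turns its coefficient \<open>d\<^sub>0\<close> into a constant, which a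
derivative removes; the zeros of the derivative are those of a two-term function.\<close>

lemma three_term_zeros:
  fixes m :: "real poly" and d\<^sub>0 d\<^sub>1 :: real and \<mu> \<nu> :: "'j \<Rightarrow> real"
  defines "h \<equiv> \<lambda>t. poly m t - d\<^sub>0 * power_product \<mu> t - d\<^sub>1 * power_product \<nu> t"
  assumes m: "degree m \<le> 1"
    and nz: "\<exists>t\<in>region. h t \<noteq> 0"
  shows "finite {t \<in> region. h t = 0} \<and> card {t \<in> region. h t = 0} \<le> 5 * card J - 2"
proof -
  define Z where "Z = {t \<in> region. h t = 0}"
  define n where "n = card J"
  have n: "n \<ge> 1" using finite_J J_nonempty by (simp add: n_def Suc_le_eq card_gt_0_iff)
  define \<gamma> where "\<gamma> = (\<lambda>j. \<nu> j - \<mu> j)"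
  define A where "A = pderiv m * forms_poly - m * dlog_poly \<mu>"
  define B where "B = smult d\<^sub>1 (dlog_poly \<gamma>)"
  define g where "g t = poly m t / power_product \<mu> t - d\<^sub>0 - d\<^sub>1 * power_product \<gamma> t" for t
  define g' where "g' t = (poly A t - power_product \<nu> t * poly B t) / (power_product \<mu> t * poly forms_poly t)" for t
  have gh: "g t = h t / power_product \<mu> t" for t
    using power_product_pos[of \<mu> t] by (simp add: g_def h_def \<gamma>_def power_product_diff field_simps)
  have g0: "g t = 0 \<longleftrightarrow> h t = 0" for t
    using power_product_pos[of \<mu> t] by (simp add: gh)
  have g'0: "g' t = 0 \<longleftrightarrow> poly A t = power_product \<nu> t * poly B t" if "t \<in> region" for t
    using power_product_pos[of \<mu> t] forms_poly_pos[OF that] by (simp add: g'_def)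
  have der: "(g has_real_derivative g' t) (at t)" if t: "t \<in> region" for t
  proof -
    have H: "power_product \<mu> t > 0" by (rule power_product_pos)
    have Q: "poly forms_poly t > 0" using forms_poly_pos t by blast
    note [derivative_intros] = power_product_derivative[OF t]
    have D: "(g has_real_derivative
       (poly (pderiv m) t * power_product \<mu> t - poly m t * (power_product \<mu> t * (poly (dlog_poly \<mu>) t / poly forms_poly t)))
         / (power_product \<mu> t * power_product \<mu> t)
       - d\<^sub>1 * (power_product \<gamma> t * (poly (dlog_poly \<gamma>) t / poly forms_poly t))) (at t)"
      unfolding g_def using H by (auto intro!: derivative_eq_intros poly_DERIV)
    have alg: "(a * H - k * (H * (s / Q))) / (H * H) - d * ((N / H) * (r / Q))
        = ((a * Q - k * s) - N * (d * r)) / (H * Q)"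
      if "H \<noteq> 0" "Q \<noteq> 0" for a H k s Q d N r :: real
    proof -
      have "(a * H - k * (H * (s / Q))) / (H * H) = (a * Q - k * s) / (H * Q)"
        using that by (simp add: divide_simps) (simp add: algebra_simps)
      moreover have "d * ((N / H) * (r / Q)) = N * (d * r) / (H * Q)" by simp
      ultimately show ?thesis by (simp only: diff_divide_distrib)
    qed
    have "power_product \<gamma> t = power_product \<nu> t / power_product \<mu> t"
      by (simp add: \<gamma>_def power_product_diff)
    moreover have "poly A t = poly (pderiv m) t * poly forms_poly t - poly m t * poly (dlog_poly \<mu>) t"
      "poly B t = d\<^sub>1 * poly (dlog_poly \<gamma>) t"
      by (simp_all add: A_def B_def)
    ultimately have "(poly (pderiv m) t * power_product \<mu> t - poly m t * (power_product \<mu> t * (poly (dlog_poly \<mu>) t / poly forms_poly t)))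
         / (power_product \<mu> t * power_product \<mu> t)
       - d\<^sub>1 * (power_product \<gamma> t * (poly (dlog_poly \<gamma>) t / poly forms_poly t)) = g' t"
      using alg[OF less_imp_neq[OF H, symmetric] less_imp_neq[OF Q, symmetric]] by (simp only: g'_def)
    with D show ?thesis by (simp only:)
  qed
  have contg: "continuous_on {x..y} g" if "x \<in> region" "y \<in> region" for x y
    using region_interval[OF that] der
    by (intro continuous_at_imp_continuous_on ballI DERIV_isCont[where D = "g' _"]) auto
  have degA: "degree A \<le> card J"
  proof -
    have "degree (pderiv m * forms_poly) \<le> card J"
      using m degree_forms_poly degree_mult_le[of "pderiv m" forms_poly] by (simp add: degree_pderiv)
    moreover have "degree (m * dlog_poly \<mu>) \<le> card J"
      using m degree_dlog_poly[of \<mu>] degree_mult_le[of m "dlog_poly \<mu>"] n unfolding n_def by linarith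
    ultimately show ?thesis unfolding A_def by (rule degree_diff_le)
  qed
  have degB: "degree B \<le> card J - 1"
    unfolding B_def by (rule order_trans[OF degree_smult_le degree_dlog_poly])
  show ?thesis
  proof (cases "\<exists>t\<in>region. poly A t \<noteq> power_product \<nu> t * poly B t")
    case True
    define S where "S = {t \<in> region. poly A t = power_product \<nu> t * poly B t}"
    have S: "finite S \<and> card S \<le> 5 * card J - 3"
      unfolding S_def by (rule two_term_zeros[OF degA degB True])
    have "\<exists>r\<in>S. x < r \<and> r < y" if zxy: "x \<in> Z" "y \<in> Z" "x < y" for x y
    proof -
      have xy: "x \<in> region" "y \<in> region" "g x = g y"
        using that g0[of x] g0[of y] by (auto simp: Z_def)
      obtain z where z: "x < z" "z < y" "g' z = 0"
        using Rolle_real[OF zxy(3) xy(3), of g'] der region_interval[OF xy(1,2)] by blast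
      moreover have "z \<in> region" using region_interval[OF xy(1,2)] z by auto
      ultimately show ?thesis using g'0 by (auto simp: S_def)
    qed
    then have "finite Z \<and> card Z \<le> card S + 1" using S by (intro card_le_card_separators) auto
    moreover have "5 * n - 3 + 1 \<le> 5 * n - 2" using n by linarith
    ultimately have "finite Z \<and> card Z \<le> 5 * n - 2" using S unfolding n_def by linarith
    then show ?thesis by (simp only: Z_def n_def)
  next
    case False
    have "g x = g y" if "x \<in> region" "y \<in> region" "x < y" for x y
    proof (rule DERIV_isconst_end[OF that(3) contg[OF that(1,2)], symmetric])
      fix s assume "x < s" "s < y"
      then have s: "s \<in> region" using region_interval[OF that(1,2)] by simp
      then show "(g has_real_derivative 0) (at s)" using der[OF s] g'0[OF s] False by metis
    qed
    then have const: "g x = g y" if "x \<in> region" "y \<in> region" for x y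
      using that by (metis linorder_cases)
    from nz obtain s where s: "s \<in> region" "g s \<noteq> 0" using g0 by blast
    have "h t \<noteq> 0" if "t \<in> region" for t using const[OF that s(1)] g0[of t] s(2) by simp
    then have no_zeros: "{t \<in> region. h t = 0} = {}" by blast
    show ?thesis unfolding no_zeros by simp
  qed
qed

end


section \<open>Critical points on compact components of a hypersurface\<close>

text \<open>The map \<open>\<Psi>\<close> straightens the level set: its derivative at \<open>p\<close> is the identity, and \<open>F z = F p\<close> holds
exactly if \<open>\<Psi> z - p\<close> is orthogonal to the gradient at \<open>p\<close>. The curve is the preimage of a line
under \<open>\<Psi>\<close>, which the inverse function theorem makes invertible near \<open>p\<close>.\<close>

lemma level_curve:
  fixes F :: "'a::euclidean_space \<Rightarrow> real" and G :: "'a \<Rightarrow> 'a"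
  assumes U: "open U" and p: "p \<in> U" and Gp: "G p \<noteq> 0"
    and der: "\<And>z. z \<in> U \<Longrightarrow> (F has_derivative (\<lambda>h. G z \<bullet> h)) (at z)"
    and cont: "continuous_on U G"
    and v: "G p \<bullet> v = 0"
  obtains \<gamma> :: "real \<Rightarrow> 'a" and \<epsilon> where "0 < \<epsilon>" "\<gamma> 0 = p" "(\<gamma> has_vector_derivative v) (at 0)"
    "continuous_on {-\<epsilon><..<\<epsilon>} \<gamma>" "\<gamma> ` {-\<epsilon><..<\<epsilon>} \<subseteq> {z \<in> U. F z = F p}"
proof -
  define u where "u = (1 / (G p \<bullet> G p)) *\<^sub>R G p"
  have Gu: "G p \<bullet> u = 1" using Gp by (simp add: u_def)
  define \<Psi> where "\<Psi> z = z + (F z - F p - G p \<bullet> (z - p)) *\<^sub>R u" for z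
  define \<Psi>' where "\<Psi>' z = id_blinfun + (blinfun_scaleR_left u o\<^sub>L blinfun_inner_left (G z - G p))" for z
  have \<Psi>': "blinfun_apply (\<Psi>' z) h = h + ((G z - G p) \<bullet> h) *\<^sub>R u" for z h
    by (simp add: \<Psi>'_def blinfun.add_left inner_commute)
  have 1: "(\<Psi> has_derivative blinfun_apply (\<Psi>' z)) (at z)" if "z \<in> U" for z
    unfolding \<Psi>_def[abs_def] \<Psi>'[abs_def]
    by (auto intro!: derivative_eq_intros der that simp: inner_diff_left fun_eq_iff)
  have 2: "continuous_on U \<Psi>'"
    unfolding \<Psi>'_def by (intro continuous_intros cont)
  have id: "\<Psi>' p = id_blinfun" by (rule blinfun_eqI) (simp add: \<Psi>')
  have inv: "id_blinfun o\<^sub>L \<Psi>' p = id_blinfun" by (rule blinfun_eqI) (simp add: id)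
  obtain U' V g g' where U': "open U'" "U' \<subseteq> U" "p \<in> U'" and V: "open V" "\<Psi> p \<in> V"
    and hom: "homeomorphism U' V \<Psi> g"
    and g: "\<And>y. y \<in> V \<Longrightarrow> (g has_derivative (g' y)) (at y)"
           "\<And>y. y \<in> V \<Longrightarrow> g' y = inv (blinfun_apply (\<Psi>' (g y)))"
           "\<And>y. y \<in> V \<Longrightarrow> bij (blinfun_apply (\<Psi>' (g y)))"
    apply (rule inverse_function_theorem[OF U 1 2 p inv])
     apply assumption
    subgoal premises prems by (rule prems(1)[OF prems(2-)])
    done
  have \<Psi>p: "\<Psi> p = p" by (simp add: \<Psi>_def)
  then have gp: "g p = p" using hom U' by (metis homeomorphism_apply1)
  have g'p: "g' p = id"
    using g(2)[of p] V \<Psi>p gp id by (simp add: id_def[symmetric] eq_id_iff[symmetric] inv_id)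
  have "\<forall>\<^sub>F t in nhds (0::real). p + t *\<^sub>R v \<in> V"
  proof -
    have "open ((\<lambda>t::real. p + t *\<^sub>R v) -` V)"
      by (intro open_vimage V continuous_intros)
    then have "\<forall>\<^sub>F t in nhds (0::real). t \<in> (\<lambda>t. p + t *\<^sub>R v) -` V"
      by (rule eventually_nhds_in_open) (use V \<Psi>p in simp)
    then show ?thesis by simp
  qed
  then obtain \<epsilon> where \<epsilon>: "\<epsilon> > 0" "\<And>t. \<bar>t\<bar> < \<epsilon> \<Longrightarrow> p + t *\<^sub>R v \<in> V"
    by (auto simp: eventually_nhds_metric dist_real_def)
  define \<gamma> where "\<gamma> t = g (p + t *\<^sub>R v)" for t
  show ?thesis
  proof (rule that[OF \<epsilon>(1)])
    show "\<gamma> 0 = p" by (simp add: \<gamma>_def gp)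
    have "((\<lambda>t::real. p + t *\<^sub>R v) has_derivative (\<lambda>t. t *\<^sub>R v)) (at 0)"
      by (auto intro!: derivative_eq_intros)
    moreover have "(g has_derivative id) (at (p + 0 *\<^sub>R v))"
      using g(1)[of p] g'p V \<Psi>p by simp
    ultimately have "((g \<circ> (\<lambda>t. p + t *\<^sub>R v)) has_derivative (id \<circ> (\<lambda>t. t *\<^sub>R v))) (at 0)"
      by (intro diff_chain_at) auto
    then show "(\<gamma> has_vector_derivative v) (at 0)"
      by (simp add: has_vector_derivative_def \<gamma>_def[abs_def] o_def)
    have "continuous_on V g" using hom by (simp add: homeomorphism_def)
    then show "continuous_on {-\<epsilon><..<\<epsilon>} \<gamma>"
      unfolding \<gamma>_def
      by (rule continuous_on_compose2) (use \<epsilon>(2) in \<open>auto intro!: continuous_intros\<close>)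
    show "\<gamma> ` {-\<epsilon><..<\<epsilon>} \<subseteq> {z \<in> U. F z = F p}"
    proof (rule image_subsetI)
      fix t assume "t \<in> {-\<epsilon><..<\<epsilon>}"
      then have tV: "p + t *\<^sub>R v \<in> V" using \<epsilon>(2)[of t] by auto
      have U'\<gamma>: "\<gamma> t \<in> U'" using hom tV by (auto simp: homeomorphism_def \<gamma>_def)
      have "\<Psi> (\<gamma> t) = p + t *\<^sub>R v" using hom tV by (simp add: homeomorphism_def \<gamma>_def)
      then have "G p \<bullet> (\<Psi> (\<gamma> t) - p) = 0" using v by simp
      moreover have "G p \<bullet> (\<Psi> z - p) = F z - F p" for z
        using Gu by (simp add: \<Psi>_def inner_add_right inner_diff_right)
      ultimately show "\<gamma> t \<in> {z \<in> U. F z = F p}" using U'\<gamma> U'(2) by auto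
    qed
  qed
qed

lemma level_curve_in_component:
  fixes F :: "'a::euclidean_space \<Rightarrow> real" and G :: "'a \<Rightarrow> 'a"
  assumes U: "open U" and Gp: "G p \<noteq> 0"
    and der: "\<And>z. z \<in> U \<Longrightarrow> (F has_derivative (\<lambda>h. G z \<bullet> h)) (at z)"
    and cont: "continuous_on U G"
    and C: "C \<in> components {z \<in> U. F z = 0}" and p: "p \<in> C"
    and v: "G p \<bullet> v = 0"
  obtains \<gamma> :: "real \<Rightarrow> 'a" and \<epsilon> where "0 < \<epsilon>" "\<gamma> 0 = p" "(\<gamma> has_vector_derivative v) (at 0)"
    "\<gamma> ` {-\<epsilon><..<\<epsilon>} \<subseteq> C"
proof -
  have pU: "p \<in> U" "F p = 0" using in_components_subset[OF C] p by auto
  obtain \<gamma> :: "real \<Rightarrow> 'a" and \<epsilon> where \<gamma>: "0 < \<epsilon>" "\<gamma> 0 = p" "(\<gamma> has_vector_derivative v) (at 0)"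
    "continuous_on {-\<epsilon><..<\<epsilon>} \<gamma>" "\<gamma> ` {-\<epsilon><..<\<epsilon>} \<subseteq> {z \<in> U. F z = 0}"
    by (rule level_curve[OF U pU(1) Gp der cont v]) (use pU(2) in auto)
  have "connected (\<gamma> ` {-\<epsilon><..<\<epsilon>})"
    by (intro connected_continuous_image \<gamma> convex_connected) auto
  moreover have "p \<in> \<gamma> ` {-\<epsilon><..<\<epsilon>}" using \<gamma>(1,2) by force
  ultimately have "\<gamma> ` {-\<epsilon><..<\<epsilon>} \<subseteq> C"
    using components_maximal[OF C] \<gamma>(5) p by blast
  with \<gamma> that show ?thesis by blast
qed

text \<open>Lagrange multipliers, for an extremum over a connected component only: level curves through \<open>p\<close> stay in
the component of \<open>p\<close>, so \<open>\<eta>\<close> has a local extremum along each of them.\<close>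

lemma gradient_parallel_at_extremum:
  fixes F \<eta> :: "'a::euclidean_space \<Rightarrow> real" and G :: "'a \<Rightarrow> 'a"
  assumes U: "open U" and Gp: "G p \<noteq> 0"
    and der: "\<And>z. z \<in> U \<Longrightarrow> (F has_derivative (\<lambda>h. G z \<bullet> h)) (at z)"
    and cont: "continuous_on U G"
    and C: "C \<in> components {z \<in> U. F z = 0}" and p: "p \<in> C"
    and ext: "(\<forall>z\<in>C. \<eta> z \<le> \<eta> p) \<or> (\<forall>z\<in>C. \<eta> p \<le> \<eta> z)"
    and \<eta>: "(\<eta> has_derivative (\<lambda>h. K \<bullet> h)) (at p)"
  shows "\<exists>c. K = c *\<^sub>R G p"
proof -
  have orth: "K \<bullet> v = 0" if v: "G p \<bullet> v = 0" for v
  proof -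
    obtain \<gamma> :: "real \<Rightarrow> 'a" and \<epsilon> where \<gamma>: "0 < \<epsilon>" "\<gamma> 0 = p" "(\<gamma> has_vector_derivative v) (at 0)"
      "\<gamma> ` {-\<epsilon><..<\<epsilon>} \<subseteq> C"
      by (rule level_curve_in_component[OF U Gp der cont C p v])
    have "((\<eta> \<circ> \<gamma>) has_derivative ((\<lambda>h. K \<bullet> h) \<circ> (\<lambda>t. t *\<^sub>R v))) (at 0)"
      using \<gamma>(2,3) \<eta> by (intro diff_chain_at) (auto simp: has_vector_derivative_def)
    then have D: "((\<lambda>t. \<eta> (\<gamma> t)) has_real_derivative (K \<bullet> v)) (at 0)"
      by (simp add: o_def has_field_derivative_def mult_commute_abs mult.commute)
    have inC: "\<gamma> t \<in> C" if "\<bar>0 - t\<bar> < \<epsilon>" for t using \<gamma>(4) that by (auto simp: abs_less_iff)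
    from ext show ?thesis
    proof
      assume "\<forall>z\<in>C. \<eta> z \<le> \<eta> p"
      then show ?thesis using DERIV_local_max[OF D \<gamma>(1)] inC \<gamma>(2) by auto
    next
      assume "\<forall>z\<in>C. \<eta> p \<le> \<eta> z"
      then show ?thesis using DERIV_local_min[OF D \<gamma>(1)] inC \<gamma>(2) by auto
    qed
  qed
  define c where "c = (K \<bullet> G p) / (G p \<bullet> G p)"
  define r where "r = K - c *\<^sub>R G p"
  have "G p \<bullet> r = 0" using Gp by (simp add: r_def c_def inner_diff_right inner_commute)
  moreover from orth[OF this] have "K \<bullet> r = 0" .
  moreover have "r \<bullet> r = K \<bullet> r - c * (G p \<bullet> r)"
    by (subst (1) r_def) (simp only: inner_diff_left inner_scaleR_left)
  ultimately have "r \<bullet> r = 0" by simp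
  then show ?thesis by (auto simp: r_def)
qed

lemma compact_component_has_critical_point:
  fixes F \<eta> :: "'a::euclidean_space \<Rightarrow> real" and G K :: "'a \<Rightarrow> 'a"
  assumes U: "open U" and G0: "\<And>z. z \<in> U \<Longrightarrow> F z = 0 \<Longrightarrow> G z \<noteq> 0"
    and der: "\<And>z. z \<in> U \<Longrightarrow> (F has_derivative (\<lambda>h. G z \<bullet> h)) (at z)"
    and cont: "continuous_on U G"
    and \<eta>: "\<And>z. z \<in> U \<Longrightarrow> (\<eta> has_derivative (\<lambda>h. K z \<bullet> h)) (at z)"
    and C: "C \<in> components {z \<in> U. F z = 0}" "compact C"
  shows "\<exists>p\<in>C. \<exists>c. K p = c *\<^sub>R G p"
proof -
  have CU: "z \<in> U" "F z = 0" if "z \<in> C" for z using in_components_subset[OF C(1)] that by auto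
  have "continuous_on C \<eta>"
    by (meson CU \<eta> continuous_at_imp_continuous_on has_derivative_continuous)
  then obtain p where p: "p \<in> C" "\<forall>z\<in>C. \<eta> z \<le> \<eta> p"
    using continuous_attains_sup[OF C(2)] in_components_nonempty[OF C(1)] by metis
  then show ?thesis
    using gradient_parallel_at_extremum[OF U G0 der cont C(1), of p \<eta> "K p"] CU[OF p(1)] \<eta>[of p] by blast
qed

text \<open>If the maximum and the minimum of \<open>\<eta>\<close> are attained only at the same point, \<open>\<eta>\<close> is constant and every
point of the component is critical. In dimension at least 2 the component contains a nonconstant
level curve, so it would then contain infinitely many critical points.\<close>

lemma two_critical_points:
  fixes F \<eta> :: "'a::euclidean_space \<Rightarrow> real" and G K :: "'a \<Rightarrow> 'a"
  assumes dim: "2 \<le> DIM('a)"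
    and U: "open U" and G0: "\<And>z. z \<in> U \<Longrightarrow> F z = 0 \<Longrightarrow> G z \<noteq> 0"
    and der: "\<And>z. z \<in> U \<Longrightarrow> (F has_derivative (\<lambda>h. G z \<bullet> h)) (at z)"
    and cont: "continuous_on U G"
    and \<eta>: "\<And>z. z \<in> U \<Longrightarrow> (\<eta> has_derivative (\<lambda>h. K z \<bullet> h)) (at z)"
    and C: "C \<in> components {z \<in> U. F z = 0}" "compact C"
    and fin: "finite {z \<in> C. \<exists>c. K z = c *\<^sub>R G z}"
  shows "2 \<le> card {z \<in> C. \<exists>c. K z = c *\<^sub>R G z}"
proof -
  have CU: "z \<in> U" "F z = 0" if "z \<in> C" for z using in_components_subset[OF C(1)] that by auto
  have "continuous_on C \<eta>"
    by (meson CU \<eta> continuous_at_imp_continuous_on has_derivative_continuous)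
  then obtain p q where p: "p \<in> C" "\<And>z. z \<in> C \<Longrightarrow> \<eta> z \<le> \<eta> p" and q: "q \<in> C" "\<And>z. z \<in> C \<Longrightarrow> \<eta> q \<le> \<eta> z"
    using continuous_attains_sup[OF C(2)] continuous_attains_inf[OF C(2)] in_components_nonempty[OF C(1)]
    by metis
  have crit: "\<exists>c. K z = c *\<^sub>R G z" if "z \<in> C" "(\<forall>w\<in>C. \<eta> w \<le> \<eta> z) \<or> (\<forall>w\<in>C. \<eta> z \<le> \<eta> w)" for z
    using gradient_parallel_at_extremum[OF U _ der cont C(1) that(1,2) \<eta>] CU[OF that(1)] G0 by blast
  have "p \<noteq> q"
  proof
    assume "p = q"
    then have "\<eta> z = \<eta> p" if "z \<in> C" for z using p q that by force
    then have "C = {z \<in> C. \<exists>c. K z = c *\<^sub>R G z}" using crit by fastforce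
    then have finC: "finite C" using fin by simp
    have Gp: "G p \<noteq> 0" using G0 CU p by blast
    obtain v where v: "v \<noteq> 0" "orthogonal (G p) v"
      using orthogonal_to_vector_exists[OF dim] by blast
    obtain \<gamma> :: "real \<Rightarrow> 'a" and \<epsilon> where \<gamma>: "0 < \<epsilon>" "\<gamma> 0 = p" "(\<gamma> has_vector_derivative v) (at 0)"
      "\<gamma> ` {-\<epsilon><..<\<epsilon>} \<subseteq> C"
      by (rule level_curve_in_component[OF U Gp der cont C(1) p(1), of v]) (use v in \<open>auto simp: orthogonal_def\<close>)
    \<comment> \<open>a continuous curve in a finite set is locally constant\<close>
    have "(\<gamma> has_vector_derivative 0) (at 0)"
    proof -
      have cont0: "isCont \<gamma> 0" using \<gamma>(3) by (rule has_vector_derivative_continuous)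
      have "open (- (C - {p}))" using finC by (intro open_Compl finite_imp_closed) auto
      then have "\<forall>\<^sub>F t in nhds 0. \<gamma> t \<in> - (C - {p})"
        using cont0 \<gamma>(2) by (intro topological_tendstoD[of \<gamma> p]) (auto simp: isCont_def tendsto_at_iff_tendsto_nhds)
      moreover have "\<forall>\<^sub>F t in nhds 0. t \<in> {-\<epsilon><..<\<epsilon>}"
        using \<gamma>(1) by (intro eventually_nhds_in_open) auto
      ultimately have "\<forall>\<^sub>F t in nhds 0. \<gamma> t = p"
      proof eventually_elim
        case (elim t)
        then have "\<gamma> t \<in> C" using \<gamma>(4) by blast
        with elim show ?case by auto
      qed
      then show ?thesis
        by (subst has_vector_derivative_cong_ev[where g = "\<lambda>_. p"]) (use \<gamma>(2) in auto)
    qed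
    with \<gamma>(3) v(1) show False using vector_derivative_unique_at by blast
  qed
  then have "card {p, q} = 2" by simp
  moreover have "{p, q} \<subseteq> {z \<in> C. \<exists>c. K z = c *\<^sub>R G z}" using crit p q by auto
  ultimately show ?thesis using card_mono[OF fin, of "{p, q}"] by simp
qed

lemma card_compact_components_le:
  fixes F \<eta> :: "'a::euclidean_space \<Rightarrow> real" and G K :: "'a \<Rightarrow> 'a"
  assumes dim: "2 \<le> DIM('a)"
    and U: "open U" and G0: "\<And>z. z \<in> U \<Longrightarrow> F z = 0 \<Longrightarrow> G z \<noteq> 0"
    and der: "\<And>z. z \<in> U \<Longrightarrow> (F has_derivative (\<lambda>h. G z \<bullet> h)) (at z)"
    and cont: "continuous_on U G"
    and \<eta>: "\<And>z. z \<in> U \<Longrightarrow> (\<eta> has_derivative (\<lambda>h. K z \<bullet> h)) (at z)"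
    and fin: "finite {z \<in> U. F z = 0 \<and> (\<exists>c. K z = c *\<^sub>R G z)}"
  defines "\<C> \<equiv> {C \<in> components {z \<in> U. F z = 0}. compact C}"
  shows "finite \<C> \<and> 2 * card \<C> \<le> card {z \<in> U. F z = 0 \<and> (\<exists>c. K z = c *\<^sub>R G z)}"
proof -
  define X where "X = {z \<in> U. F z = 0 \<and> (\<exists>c. K z = c *\<^sub>R G z)}"
  have XC: "{z \<in> C. \<exists>c. K z = c *\<^sub>R G z} = C \<inter> X" if "C \<in> \<C>" for C
    using in_components_subset that by (fastforce simp: \<C>_def X_def)
  have finX: "finite X" using fin by (simp add: X_def)
  have two: "2 \<le> card (C \<inter> X)" if "C \<in> \<C>" for C
    using two_critical_points[OF dim U G0 der cont \<eta>, of C] that finX XC[OF that] by (simp add: \<C>_def)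
  have disj: "C \<inter> X \<inter> (D \<inter> X) = {}" if "C \<in> \<C>" "D \<in> \<C>" "C \<noteq> D" for C D
    using components_nonoverlap that by (fastforce simp: \<C>_def)
  have inj: "inj_on (\<lambda>C. C \<inter> X) \<C>"
  proof (rule inj_onI)
    fix C D assume *: "C \<in> \<C>" "D \<in> \<C>" "C \<inter> X = D \<inter> X"
    show "C = D" using disj[of C D] two[of C] * by (cases "C = D") auto
  qed
  have "finite ((\<lambda>C. C \<inter> X) ` \<C>)" using finX by (rule_tac finite_subset[of _ "Pow X"]) auto
  then have fC: "finite \<C>" using inj by (rule finite_imageD)
  have "2 * card \<C> = (\<Sum>C\<in>\<C>. 2)" by simp
  also have "\<dots> \<le> (\<Sum>C\<in>\<C>. card (C \<inter> X))" using two by (intro sum_mono)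
  also have "\<dots> = card (\<Union>C\<in>\<C>. C \<inter> X)"
    using fC finX disj by (subst card_UN_disjoint) auto
  also have "\<dots> \<le> card X" using finX by (intro card_mono) auto
  finally show ?thesis using fC by (simp add: X_def)
qed


section \<open>Gale duality for two exponents more than an affine basis\<close>

text \<open>An exponential sum on a Euclidean space (a polynomial with real exponents in logarithmic coordinates)
whose exponents are an affine basis \<open>U\<close> and two further vectors with barycentric coordinates \<open>\<mu>\<^sub>0\<close> and
\<open>\<mu>\<^sub>1\<close>. All exponentials are divided by that of \<open>u\<^sub>0\<close>; since \<open>\<mu>\<^sub>0 u\<^sub>0 \<noteq> 0\<close>,
the form \<open>gale_form u\<^sub>0\<close> below is not zero, and its value can be normalised to 1.\<close>

locale two_extra_exponents =
  fixes U :: "'a::euclidean_space set" and u\<^sub>0 w\<^sub>0 w\<^sub>1 :: 'a and \<mu>\<^sub>0 \<mu>\<^sub>1 c :: "'a \<Rightarrow> real" and d\<^sub>0 d\<^sub>1 :: real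
  assumes finite_U: "finite U" and independent: "\<not> affine_dependent U" and full: "affine hull U = UNIV"
    and dim_pos: "2 \<le> card U"
    and u0: "u\<^sub>0 \<in> U" "\<mu>\<^sub>0 u\<^sub>0 \<noteq> 0"
    and distinct: "w\<^sub>0 \<noteq> w\<^sub>1"
    and \<mu>\<^sub>0: "(\<Sum>u\<in>U. \<mu>\<^sub>0 u) = 1" "(\<Sum>u\<in>U. \<mu>\<^sub>0 u *\<^sub>R u) = w\<^sub>0"
    and \<mu>\<^sub>1: "(\<Sum>u\<in>U. \<mu>\<^sub>1 u) = 1" "(\<Sum>u\<in>U. \<mu>\<^sub>1 u *\<^sub>R u) = w\<^sub>1"
    and c: "\<And>u. u \<in> U \<Longrightarrow> c u \<noteq> 0"
begin

definition J :: "'a set" where "J = U - {u\<^sub>0}"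

definition exp_sum :: "'a \<Rightarrow> real" where
  "exp_sum x = (\<Sum>u\<in>U. c u * exp (u \<bullet> x)) + d\<^sub>0 * exp (w\<^sub>0 \<bullet> x) + d\<^sub>1 * exp (w\<^sub>1 \<bullet> x)"

definition exp_grad :: "'a \<Rightarrow> 'a" where
  "exp_grad x = (\<Sum>u\<in>U. (c u * exp (u \<bullet> x)) *\<^sub>R u) + (d\<^sub>0 * exp (w\<^sub>0 \<bullet> x)) *\<^sub>R w\<^sub>0 + (d\<^sub>1 * exp (w\<^sub>1 \<bullet> x)) *\<^sub>R w\<^sub>1"

definition k\<^sub>0 :: real where "k\<^sub>0 = - \<mu>\<^sub>0 u\<^sub>0 / c u\<^sub>0"
definition k\<^sub>1 :: real where "k\<^sub>1 = - \<mu>\<^sub>1 u\<^sub>0 / c u\<^sub>0"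

text \<open>At a critical point \<open>exp (u \<bullet> x)\<close> is the value of \<open>gale_form u\<close> at a point \<open>(P, Q)\<close> of the plane. The pair
\<open>(k\<^sub>0, k\<^sub>1)\<close> consists of the coefficients of \<open>gale_form u\<^sub>0\<close>, so the line \<open>gale_form u\<^sub>0 = 1\<close> is
parametrised by \<open>t \<mapsto> (k\<^sub>0, k\<^sub>1) / \<bar>(k\<^sub>0, k\<^sub>1)\<bar>\<^sup>2 + t (- k\<^sub>1, k\<^sub>0)\<close>. The restrictions of the other forms to
this line are the affine functions \<open>\<alpha> u + \<beta> u t\<close>, and \<open>gale_line\<close> below is the restriction of \<open>P + Q\<close>.\<close>

definition gale_form :: "'a \<Rightarrow> real \<Rightarrow> real \<Rightarrow> real" where
  "gale_form u P Q = - (\<mu>\<^sub>0 u * P + \<mu>\<^sub>1 u * Q) / c u"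

definition \<alpha> :: "'a \<Rightarrow> real" where "\<alpha> u = gale_form u (k\<^sub>0 / (k\<^sub>0\<^sup>2 + k\<^sub>1\<^sup>2)) (k\<^sub>1 / (k\<^sub>0\<^sup>2 + k\<^sub>1\<^sup>2))"
definition \<beta> :: "'a \<Rightarrow> real" where "\<beta> u = gale_form u (- k\<^sub>1) k\<^sub>0"

lemma finite_J: "finite J" and J_nonempty: "J \<noteq> {}" and card_J: "card J = card U - 1"
proof -
  show "finite J" using finite_U by (simp add: J_def)
  show *: "card J = card U - 1" using finite_U u0 by (simp add: J_def)
  show "J \<noteq> {}" using * dim_pos by auto
qed

sublocale affine_forms J \<alpha> \<beta>
  by unfold_locales (rule finite_J J_nonempty)+

definition gale_line :: "real poly" where
  "gale_line = [:(k\<^sub>0 + k\<^sub>1) / (k\<^sub>0\<^sup>2 + k\<^sub>1\<^sup>2), k\<^sub>0 - k\<^sub>1:]"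

definition gale_fun :: "real \<Rightarrow> real" where
  "gale_fun t = poly gale_line t - d\<^sub>0 * power_product \<mu>\<^sub>0 t - d\<^sub>1 * power_product \<mu>\<^sub>1 t"

lemma k_nonzero: "k\<^sub>0\<^sup>2 + k\<^sub>1\<^sup>2 > 0"
proof -
  have "k\<^sub>0 \<noteq> 0" using u0 c by (simp add: k\<^sub>0_def)
  then show ?thesis by (simp add: sum_power2_gt_zero_iff)
qed

lemma sum_U: "(\<Sum>u\<in>U. g u) = g u\<^sub>0 + (\<Sum>u\<in>J. g u)" for g :: "'a \<Rightarrow> 'b::comm_monoid_add"
  unfolding J_def using finite_U u0 by (simp add: sum.remove)

lemma barycentric:
  assumes "(\<Sum>u\<in>U. \<gamma> u) = 1" "(\<Sum>u\<in>U. \<gamma> u *\<^sub>R u) = w"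
  shows "(\<Sum>u\<in>J. \<gamma> u *\<^sub>R (u - u\<^sub>0)) = w - u\<^sub>0"
proof -
  have "(\<Sum>u\<in>U. \<gamma> u *\<^sub>R (u - u\<^sub>0)) = w - (\<Sum>u\<in>U. \<gamma> u) *\<^sub>R u\<^sub>0"
    using assms(2) by (simp add: scaleR_diff_right sum_subtractf scaleR_sum_left)
  then show ?thesis using assms(1) by (simp add: sum_U)
qed

text \<open>The differences \<open>u - u\<^sub>0\<close> form a basis, so each parameter in \<open>region\<close> is realised by exactly one point.\<close>

definition realises :: "'a \<Rightarrow> real \<Rightarrow> bool" where
  "realises x t \<longleftrightarrow> (\<forall>u\<in>J. exp ((u - u\<^sub>0) \<bullet> x) = form u t)"

lemma realises_region: "realises x t \<Longrightarrow> t \<in> region"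
  unfolding realises_def region_def by (auto, metis exp_gt_zero)

lemma power_product_realises:
  assumes r: "realises x t" and \<gamma>: "(\<Sum>u\<in>U. \<gamma> u) = 1" "(\<Sum>u\<in>U. \<gamma> u *\<^sub>R u) = w"
  shows "exp (w \<bullet> x) = exp (u\<^sub>0 \<bullet> x) * power_product \<gamma> t"
proof -
  have "ln (form u t) = (u - u\<^sub>0) \<bullet> x" if "u \<in> J" for u
    using r that unfolding realises_def by (metis ln_exp)
  then have "(\<Sum>u\<in>J. \<gamma> u * ln (form u t)) = (\<Sum>u\<in>J. \<gamma> u *\<^sub>R (u - u\<^sub>0)) \<bullet> x"
    by (simp add: inner_sum_left)
  also have "\<dots> = w \<bullet> x - u\<^sub>0 \<bullet> x" using barycentric[OF \<gamma>] by (simp add: inner_diff_left)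
  finally show ?thesis by (simp add: power_product_def exp_add[symmetric])
qed

lemma gale_form_u0: "gale_form u\<^sub>0 P Q = k\<^sub>0 * P + k\<^sub>1 * Q"
  by (simp add: gale_form_def k\<^sub>0_def k\<^sub>1_def add_divide_distrib diff_divide_distrib)

lemma form_eq:
  "form u t = gale_form u (k\<^sub>0 / (k\<^sub>0\<^sup>2 + k\<^sub>1\<^sup>2) - k\<^sub>1 * t) (k\<^sub>1 / (k\<^sub>0\<^sup>2 + k\<^sub>1\<^sup>2) + k\<^sub>0 * t)"
proof -
  have lin: "gale_form u a b + gale_form u a' b' * t = gale_form u (a + a' * t) (b + b' * t)" for a b a' b'
    by (simp add: gale_form_def add_divide_distrib[symmetric] diff_divide_distrib[symmetric] algebra_simps)
  show ?thesis unfolding form_def \<alpha>_def \<beta>_def lin by simp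
qed

lemma poly_gale_line: "poly gale_line t = (k\<^sub>0 / (k\<^sub>0\<^sup>2 + k\<^sub>1\<^sup>2) - k\<^sub>1 * t) + (k\<^sub>1 / (k\<^sub>0\<^sup>2 + k\<^sub>1\<^sup>2) + k\<^sub>0 * t)"
  by (simp add: gale_line_def add_divide_distrib algebra_simps)

text \<open>The Lagrange equation and the equation of the zero set combine to an affine relation \<open>\<Sum> M u = 0\<close>,
\<open>\<Sum> M u u = 0\<close> among the elements of \<open>U\<close>, with the multiplier \<open>\<tau>\<close> absorbed in \<open>P\<close> and \<open>Q\<close>. Affine
independence makes every \<open>M u\<close> vanish, which expresses all exponentials in terms of \<open>P\<close> and \<open>Q\<close>.
The sum \<open>P + Q\<close> no longer contains \<open>\<tau>\<close>; comparing its two expressions gives the equation for \<open>t\<close>.\<close>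

lemma critical_realises:
  assumes zero: "exp_sum x = 0" and crit: "exp_grad x = \<tau> *\<^sub>R (w\<^sub>1 - w\<^sub>0)"
  shows "\<exists>t. realises x t \<and> gale_fun t = 0"
proof -
  define A B where "A = exp (w\<^sub>0 \<bullet> x)" and "B = exp (w\<^sub>1 \<bullet> x)"
  define P Q where "P = d\<^sub>0 * A + \<tau>" and "Q = d\<^sub>1 * B - \<tau>"
  define M where "M u = c u * exp (u \<bullet> x) + \<mu>\<^sub>0 u * P + \<mu>\<^sub>1 u * Q" for u
  have 1: "(\<Sum>u\<in>U. M u) = 0"
    using zero \<mu>\<^sub>0(1) \<mu>\<^sub>1(1)
    by (simp add: M_def sum.distrib sum_distrib_right[symmetric] exp_sum_def P_def Q_def A_def B_def)
  have 2: "(\<Sum>u\<in>U. M u *\<^sub>R u) = 0"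
  proof -
    have "(\<Sum>u\<in>U. M u *\<^sub>R u) = (\<Sum>u\<in>U. (c u * exp (u \<bullet> x)) *\<^sub>R u) + P *\<^sub>R (\<Sum>u\<in>U. \<mu>\<^sub>0 u *\<^sub>R u) + Q *\<^sub>R (\<Sum>u\<in>U. \<mu>\<^sub>1 u *\<^sub>R u)"
      by (simp add: M_def scaleR_add_left sum.distrib scaleR_sum_right mult.commute)
    also have "\<dots> = exp_grad x - \<tau> *\<^sub>R (w\<^sub>1 - w\<^sub>0)"
      unfolding \<mu>\<^sub>0(2) \<mu>\<^sub>1(2) exp_grad_def P_def Q_def A_def B_def by (simp add: algebra_simps)
    finally show ?thesis using crit by simp
  qed
  have M0: "M u = 0" if "u \<in> U" for u
    using independent 1 2 that affine_dependent_explicit_finite[OF finite_U] by blast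
  have M: "exp (u \<bullet> x) = gale_form u P Q" if "u \<in> U" for u
  proof -
    have "exp (u \<bullet> x) * c u = - (\<mu>\<^sub>0 u * P + \<mu>\<^sub>1 u * Q)"
      using M0[OF that] unfolding M_def by (simp add: mult.commute)
    then show ?thesis using c[OF that] by (simp add: gale_form_def eq_divide_eq)
  qed
  define D where "D = k\<^sub>0\<^sup>2 + k\<^sub>1\<^sup>2"
  have D: "D > 0" using k_nonzero by (simp add: D_def)
  define \<rho> where "\<rho> = exp (u\<^sub>0 \<bullet> x)"
  have "\<rho> = k\<^sub>0 * P + k\<^sub>1 * Q"
    unfolding \<rho>_def M[OF u0(1)] by (rule gale_form_u0)
  moreover have "\<rho> > 0" by (simp add: \<rho>_def)
  ultimately have \<rho>: "\<rho> > 0" "\<rho> = k\<^sub>0 * P + k\<^sub>1 * Q" by blast+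
  \<comment> \<open>the coefficient of (P, Q) along (- k1, k0), after scaling (P, Q) onto the line gale_form u0 = 1\<close>
  define t where "t = (k\<^sub>0 * Q - k\<^sub>1 * P) / (\<rho> * D)"
  have P: "k\<^sub>0 / D - k\<^sub>1 * t = P / \<rho>"
  proof -
    have "k\<^sub>0 / D - k\<^sub>1 * t = (k\<^sub>0 * \<rho> - k\<^sub>1 * (k\<^sub>0 * Q - k\<^sub>1 * P)) / (\<rho> * D)"
      using D \<rho>(1) by (simp add: t_def diff_divide_distrib right_diff_distrib)
    also have "k\<^sub>0 * \<rho> - k\<^sub>1 * (k\<^sub>0 * Q - k\<^sub>1 * P) = P * D"
      unfolding \<rho>(2) D_def by (simp add: algebra_simps power2_eq_square)
    finally show ?thesis using D by simp
  qed
  have Q: "k\<^sub>1 / D + k\<^sub>0 * t = Q / \<rho>"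
  proof -
    have "k\<^sub>1 / D + k\<^sub>0 * t = (k\<^sub>1 * \<rho> + k\<^sub>0 * (k\<^sub>0 * Q - k\<^sub>1 * P)) / (\<rho> * D)"
      using D \<rho>(1) by (simp add: t_def add_divide_distrib diff_divide_distrib right_diff_distrib)
    also have "k\<^sub>1 * \<rho> + k\<^sub>0 * (k\<^sub>0 * Q - k\<^sub>1 * P) = Q * D"
      unfolding \<rho>(2) D_def by (simp add: algebra_simps power2_eq_square)
    finally show ?thesis using D by simp
  qed
  have r: "realises x t"
    unfolding realises_def
  proof
    fix u assume "u \<in> J"
    then have "exp (u \<bullet> x) = gale_form u P Q" using M by (simp add: J_def)
    then have "exp ((u - u\<^sub>0) \<bullet> x) = gale_form u P Q / \<rho>"
      by (simp add: inner_diff_left exp_diff \<rho>_def)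
    also have "\<dots> = gale_form u (P / \<rho>) (Q / \<rho>)"
      by (simp add: gale_form_def add_divide_distrib diff_divide_distrib mult.commute)
    also have "\<dots> = form u t" by (simp only: form_eq P[unfolded D_def] Q[unfolded D_def])
    finally show "exp ((u - u\<^sub>0) \<bullet> x) = form u t" .
  qed
  have "\<rho> * gale_fun t = (P + Q) - d\<^sub>0 * (\<rho> * power_product \<mu>\<^sub>0 t) - d\<^sub>1 * (\<rho> * power_product \<mu>\<^sub>1 t)"
    using \<rho>(1) unfolding gale_fun_def poly_gale_line P[unfolded D_def] Q[unfolded D_def] by (simp add: algebra_simps)
  also have "\<dots> = P + Q - d\<^sub>0 * A - d\<^sub>1 * B"
    using power_product_realises[OF r \<mu>\<^sub>0] power_product_realises[OF r \<mu>\<^sub>1] by (simp add: A_def B_def \<rho>_def)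
  also have "\<dots> = 0" by (simp add: P_def Q_def)
  finally have "gale_fun t = 0" using \<rho>(1) by simp
  with r show ?thesis by blast
qed

text \<open>The converse direction, used when \<open>gale_fun\<close> vanishes identically: every realised parameter then gives
a point of the zero set.\<close>

lemma realises_zero:
  assumes r: "realises x t" and "gale_fun t = 0"
  shows "exp_sum x = 0"
proof -
  define \<rho> where "\<rho> = exp (u\<^sub>0 \<bullet> x)"
  define P where "P = k\<^sub>0 / (k\<^sub>0\<^sup>2 + k\<^sub>1\<^sup>2) - k\<^sub>1 * t"
  define Q where "Q = k\<^sub>1 / (k\<^sub>0\<^sup>2 + k\<^sub>1\<^sup>2) + k\<^sub>0 * t"
  have "c u * exp (u \<bullet> x) = - \<rho> * (\<mu>\<^sub>0 u * P + \<mu>\<^sub>1 u * Q)" if u: "u \<in> U" for u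
  proof -
    have "exp (u \<bullet> x) = \<rho> * gale_form u P Q"
    proof (cases "u = u\<^sub>0")
      case True
      define D where "D = k\<^sub>0\<^sup>2 + k\<^sub>1\<^sup>2"
      have "gale_form u\<^sub>0 P Q = k\<^sub>0 * k\<^sub>0 / D + k\<^sub>1 * k\<^sub>1 / D"
        unfolding gale_form_u0 P_def Q_def D_def[symmetric] by (simp add: algebra_simps)
      also have "\<dots> = D / D" by (simp only: D_def add_divide_distrib power2_eq_square)
      finally have "gale_form u\<^sub>0 P Q = D / D" .
      moreover have "D > 0" unfolding D_def by (rule k_nonzero)
      ultimately show ?thesis using True by (simp add: \<rho>_def)
    next
      case False
      then have "u \<in> J" using u by (simp add: J_def)
      then have "exp ((u - u\<^sub>0) \<bullet> x) = gale_form u P Q"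
        using r by (simp only: realises_def form_eq P_def Q_def)
      then show ?thesis by (simp add: \<rho>_def inner_diff_left exp_diff divide_eq_eq mult.commute)
    qed
    then show ?thesis using c[OF u] by (simp add: gale_form_def field_simps)
  qed
  then have "(\<Sum>u\<in>U. c u * exp (u \<bullet> x)) = (\<Sum>u\<in>U. - \<rho> * (\<mu>\<^sub>0 u * P + \<mu>\<^sub>1 u * Q))"
    by (rule sum.cong[OF refl])
  also have "\<dots> = - \<rho> * (P + Q)"
    using \<mu>\<^sub>0(1) \<mu>\<^sub>1(1) by (simp add: sum_distrib_left[symmetric] sum.distrib sum_distrib_right[symmetric] sum_negf)
  finally have "exp_sum x = - \<rho> * gale_fun t"
    using power_product_realises[OF r \<mu>\<^sub>0] power_product_realises[OF r \<mu>\<^sub>1]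
    by (simp add: exp_sum_def gale_fun_def poly_gale_line P_def Q_def \<rho>_def algebra_simps)
  then show ?thesis using assms by simp
qed

lemma differences_span: "span ((\<lambda>u. u - u\<^sub>0) ` J) = UNIV"
proof -
  have "affine hull U = (\<lambda>x. u\<^sub>0 + x) ` span ((\<lambda>x. - u\<^sub>0 + x) ` J)"
    using affine_hull_span2[of u\<^sub>0 U] u0 by (auto simp: J_def)
  then have "(\<lambda>x. u\<^sub>0 + x) ` span ((\<lambda>x. - u\<^sub>0 + x) ` J) = UNIV" using full by simp
  then have "span ((\<lambda>x. - u\<^sub>0 + x) ` J) = UNIV"
    by (metis (no_types, lifting) UNIV_I UNIV_eq_I add_left_cancel imageE)
  then show ?thesis by simp
qed

lemma realises_unique:
  assumes "realises x t" "realises y t"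
  shows "x = y"
proof -
  have "(u - u\<^sub>0) \<bullet> x = (u - u\<^sub>0) \<bullet> y" if "u \<in> J" for u
    using assms that unfolding realises_def by (metis exp_inj_iff)
  then have "orthogonal (x - y) b" if "b \<in> (\<lambda>u. u - u\<^sub>0) ` J" for b
    using that by (auto simp: orthogonal_def inner_diff_left inner_diff_right inner_commute)
  then have "orthogonal (x - y) (x - y)"
    using orthogonal_to_span[of "x - y" "(\<lambda>u. u - u\<^sub>0) ` J"] differences_span by blast
  then show ?thesis by (simp add: orthogonal_def)
qed

lemma realising_curve:
  obtains \<xi> where "continuous_on region \<xi>" "\<And>t. t \<in> region \<Longrightarrow> realises (\<xi> t) t"
proof -
  let ?B = "(\<lambda>u. u - u\<^sub>0) ` J"
  have ind: "independent ?B"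
    using independent u0 affine_dependent_iff_dependent2[of u\<^sub>0 U] by (simp add: J_def)
  have "\<exists>v. \<forall>u'\<in>J. (u' - u\<^sub>0) \<bullet> v = (if u' = u then 1 else 0)" if "u \<in> J" for u
  proof -
    obtain g :: "'a \<Rightarrow> real" where g: "linear g" "\<forall>b\<in>?B. g b = (if b = u - u\<^sub>0 then 1 else 0)"
      using linear_independent_extend[OF ind, of "\<lambda>b. if b = u - u\<^sub>0 then 1 else (0::real)"] by blast
    have "(u' - u\<^sub>0) \<bullet> adjoint g 1 = (if u' = u then 1 else 0)" if "u' \<in> J" for u'
      using g that by (simp add: adjoint_works)
    then show ?thesis by blast
  qed
  then obtain v where v: "\<And>u u'. u \<in> J \<Longrightarrow> u' \<in> J \<Longrightarrow> (u' - u\<^sub>0) \<bullet> v u = (if u' = u then 1 else 0)"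
    by metis
  define \<xi> where "\<xi> t = (\<Sum>u\<in>J. ln (form u t) *\<^sub>R v u)" for t
  show ?thesis
  proof
    show "continuous_on region \<xi>"
      unfolding \<xi>_def form_def
      by (intro continuous_intros) (auto simp: region_def form_def)
    fix t assume t: "t \<in> region"
    show "realises (\<xi> t) t"
      unfolding realises_def
    proof
      fix u assume u: "u \<in> J"
      have "(u - u\<^sub>0) \<bullet> \<xi> t = (\<Sum>u'\<in>J. if u' = u then ln (form u t) else 0)"
        unfolding \<xi>_def inner_sum_right using v u by (intro sum.cong) auto
      also have "\<dots> = ln (form u t)" using u finite_J by simp
      finally show "exp ((u - u\<^sub>0) \<bullet> \<xi> t) = form u t" using t u by (simp add: region_def)
    qed
  qed
qed

lemma card_critical_le:
  assumes "\<exists>t\<in>region. gale_fun t \<noteq> 0"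
  defines "X \<equiv> {x. exp_sum x = 0 \<and> (\<exists>\<tau>. exp_grad x = \<tau> *\<^sub>R (w\<^sub>1 - w\<^sub>0))}"
  shows "finite X \<and> card X \<le> 5 * card J - 2"
proof -
  have "\<forall>x\<in>X. \<exists>t. realises x t \<and> gale_fun t = 0" using critical_realises by (auto simp: X_def)
  then obtain T where T: "\<And>x. x \<in> X \<Longrightarrow> realises x (T x)" "\<And>x. x \<in> X \<Longrightarrow> gale_fun (T x) = 0" by metis
  have inj: "inj_on T X" using T(1) realises_unique by (metis inj_onI)
  have sub: "T ` X \<subseteq> {t \<in> region. gale_fun t = 0}" using T realises_region by auto
  have "degree gale_line \<le> 1" by (simp add: gale_line_def)
  then have fin: "finite {t \<in> region. gale_fun t = 0}" "card {t \<in> region. gale_fun t = 0} \<le> 5 * card J - 2"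
    using three_term_zeros[of gale_line d\<^sub>0 \<mu>\<^sub>0 d\<^sub>1 \<mu>\<^sub>1] assms(1) unfolding gale_fun_def by auto
  show ?thesis
    using inj_on_finite[OF inj sub fin(1)] card_inj_on_le[OF inj sub fin(1)] fin(2) by auto
qed

text \<open>Positive lower bounds for all forms make \<open>region\<close> closed as well as open, hence equal to the whole line,
where a positive affine function is constant. All forms being constant means that \<open>\<mu>\<^sub>0\<close> and \<open>\<mu>\<^sub>1\<close> are
proportional; their sums are both 1, so they agree, contradicting \<open>w\<^sub>0 \<noteq> w\<^sub>1\<close>.\<close>

lemma forms_not_bounded_below:
  assumes ne: "region \<noteq> {}" and pos: "\<And>u. u \<in> J \<Longrightarrow> 0 < \<delta> u"
    and bound: "\<And>u t. u \<in> J \<Longrightarrow> t \<in> region \<Longrightarrow> \<delta> u \<le> form u t"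
  shows False
proof -
  have eq: "region = (\<Inter>u\<in>J. {t. \<delta> u \<le> form u t})"
    using bound pos by (fastforce simp: region_def)
  have "closed region"
    unfolding eq form_def by (intro closed_INT ballI closed_Collect_le continuous_intros)
  then have UNIV: "region = UNIV" using ne open_region clopen by blast
  have "\<beta> u = 0" if u: "u \<in> J" for u
  proof (rule ccontr)
    assume "\<beta> u \<noteq> 0"
    then have "form u (- \<alpha> u / \<beta> u) = 0" by (simp add: form_def)
    moreover have "- \<alpha> u / \<beta> u \<in> region" using UNIV by blast
    ultimately show False using u by (auto simp: region_def)
  qed
  moreover have "\<beta> u\<^sub>0 = 0" by (simp add: \<beta>_def gale_form_u0 mult.commute)
  ultimately have \<beta>0: "\<beta> u = 0" if "u \<in> U" for u using that by (cases "u = u\<^sub>0") (auto simp: J_def)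
  have rel: "\<mu>\<^sub>1 u * k\<^sub>0 = \<mu>\<^sub>0 u * k\<^sub>1" if "u \<in> U" for u
    using \<beta>0[OF that] c[OF that] by (simp add: \<beta>_def gale_form_def)
  have k: "k\<^sub>0 = k\<^sub>1"
  proof -
    have "(\<Sum>u\<in>U. \<mu>\<^sub>1 u) * k\<^sub>0 = (\<Sum>u\<in>U. \<mu>\<^sub>0 u) * k\<^sub>1"
      unfolding sum_distrib_right using rel by (rule sum.cong[OF refl])
    then show ?thesis using \<mu>\<^sub>0(1) \<mu>\<^sub>1(1) by simp
  qed
  then have "k\<^sub>0 \<noteq> 0" using k_nonzero by auto
  then have "\<mu>\<^sub>1 u = \<mu>\<^sub>0 u" if "u \<in> U" for u using rel[OF that] k by simp
  then have "w\<^sub>1 = w\<^sub>0" using \<mu>\<^sub>0(2) \<mu>\<^sub>1(2) by (metis (no_types, lifting) sum.cong)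
  then show False using distinct by simp
qed

end


section \<open>Counting compact components\<close>

definition log_coords :: "real^'n \<Rightarrow> real^'n" where
  "log_coords z = (\<chi> i. ln (z $ i))"

definition rp_gradient :: "'n::finite rpoly \<Rightarrow> real^'n \<Rightarrow> real^'n" where
  "rp_gradient f z =
     (\<chi> i. (\<Sum>w\<in>Poly_Mapping.keys f. Poly_Mapping.lookup f w * w $ i * monom_at w z) / z $ i)"

lemma monom_at_exp:
  assumes "z \<in> pos_orthant"
  shows "monom_at w z = exp (w \<bullet> log_coords z)"
proof -
  have "z $ i powr w $ i = exp (w $ i * ln (z $ i))" for i
    using pos_orthantD[OF assms, of i] by (simp add: powr_def)
  then show ?thesis
    by (simp add: monom_at_def log_coords_def inner_vec_def exp_sum)
qed

lemma log_coords_inj: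
  assumes "z \<in> pos_orthant" "z' \<in> pos_orthant" "log_coords z = log_coords z'"
  shows "z = z'"
proof -
  have "ln (z $ i) = ln (z' $ i)" for i
    using assms(3) by (metis log_coords_def vec_lambda_beta)
  then show ?thesis
    using pos_orthantD[OF assms(1)] pos_orthantD[OF assms(2)] by (simp add: vec_eq_iff)
qed

lemma continuous_on_monom_at: "continuous_on pos_orthant (monom_at w)"
  by (meson continuous_at_imp_continuous_on has_derivative_continuous monom_at_has_derivative)

lemma rp_eval_has_gradient:
  assumes z: "z \<in> pos_orthant"
  shows "(rp_eval f has_derivative (\<lambda>h. rp_gradient f z \<bullet> h)) (at z)"
proof -
  have D: "(rp_eval f has_derivative
      (\<lambda>h. \<Sum>w\<in>Poly_Mapping.keys f. Poly_Mapping.lookup f w * (monom_at w z * (\<Sum>i\<in>UNIV. w $ i * h $ i / z $ i)))) (at z)"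
    unfolding rp_eval_def[abs_def]
    by (intro has_derivative_sum has_derivative_mult_right monom_at_has_derivative z)
  have "(\<Sum>w\<in>Poly_Mapping.keys f. Poly_Mapping.lookup f w * (monom_at w z * (\<Sum>i\<in>UNIV. w $ i * h $ i / z $ i)))
      = rp_gradient f z \<bullet> h" for h
  proof -
    have "(\<Sum>w\<in>Poly_Mapping.keys f. Poly_Mapping.lookup f w * (monom_at w z * (\<Sum>i\<in>UNIV. w $ i * h $ i / z $ i)))
        = (\<Sum>w\<in>Poly_Mapping.keys f. \<Sum>i\<in>UNIV. Poly_Mapping.lookup f w * w $ i * monom_at w z / z $ i * h $ i)"
      by (simp add: sum_distrib_left mult_ac)
    also have "\<dots> = (\<Sum>i\<in>UNIV. \<Sum>w\<in>Poly_Mapping.keys f. Poly_Mapping.lookup f w * w $ i * monom_at w z / z $ i * h $ i)"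
      by (rule sum.swap)
    also have "\<dots> = rp_gradient f z \<bullet> h"
      by (simp add: rp_gradient_def inner_vec_def sum_distrib_right sum_divide_distrib)
    finally show ?thesis .
  qed
  with D show ?thesis by simp
qed

lemma continuous_on_rp_gradient: "continuous_on pos_orthant (rp_gradient f)"
  unfolding rp_gradient_def
  by (intro continuous_on_vec_lambda continuous_intros continuous_on_monom_at)
     (auto simp: pos_orthant_def less_imp_neq[symmetric])

lemma log_linear_has_gradient:
  fixes \<xi> :: "real^'n::finite"
  assumes z: "z \<in> pos_orthant"
  shows "((\<lambda>z. \<xi> \<bullet> log_coords z) has_derivative (\<lambda>h. (\<chi> i. \<xi> $ i / z $ i) \<bullet> h)) (at z)"
proof -
  have pos: "0 < z $ i" for i using pos_orthantD[OF z] .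
  have "((\<lambda>x. \<xi> $ i * ln (x $ i)) has_derivative (\<lambda>h. \<xi> $ i * (h $ i * inverse (z $ i)))) (at z)" for i
    by (intro has_derivative_mult_right has_derivative_ln pos
        bounded_linear_imp_has_derivative bounded_linear_vec_nth)
  then have "((\<lambda>x. \<Sum>i\<in>UNIV. \<xi> $ i * ln (x $ i)) has_derivative
      (\<lambda>h. \<Sum>i\<in>UNIV. \<xi> $ i * (h $ i * inverse (z $ i)))) (at z)"
    by (rule has_derivative_sum)
  then show ?thesis
    by (simp add: inner_vec_def log_coords_def divide_inverse mult_ac)
qed

text \<open>In logarithmic coordinates the Lagrange equation reads: the combination of the exponents weighted by
the terms of the polynomial is a multiple of \<open>\<xi>\<close>.\<close>

lemma rp_gradient_parallel:
  fixes \<xi> :: "real^'n::finite"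
  assumes z: "z \<in> pos_orthant" and "\<xi> \<noteq> 0" and par: "(\<chi> i. \<xi> $ i / z $ i) = c *\<^sub>R rp_gradient f z"
  shows "\<exists>\<tau>. (\<Sum>w\<in>Poly_Mapping.keys f. (Poly_Mapping.lookup f w * monom_at w z) *\<^sub>R w) = \<tau> *\<^sub>R \<xi>"
proof -
  define s where "s = (\<Sum>w\<in>Poly_Mapping.keys f. (Poly_Mapping.lookup f w * monom_at w z) *\<^sub>R w)"
  have "\<xi> $ i = c * s $ i" for i
  proof -
    have "\<xi> $ i / z $ i = c * (s $ i / z $ i)"
      using arg_cong[OF par, of "\<lambda>v. v $ i"] by (simp add: rp_gradient_def s_def mult_ac)
    then show ?thesis using pos_orthantD[OF z, of i] by (simp add: field_simps)
  qed
  then have \<xi>: "\<xi> = c *\<^sub>R s" by (simp add: vec_eq_iff)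
  then have "c \<noteq> 0" using \<open>\<xi> \<noteq> 0\<close> by auto
  then have "s = (1 / c) *\<^sub>R \<xi>" using \<xi> by simp
  then show ?thesis unfolding s_def by blast
qed

lemma affine_basis_with_two_more:
  fixes W :: "'a::euclidean_space set"
  assumes "finite W" "card W = DIM('a) + 3" "affine hull W = UNIV"
  obtains U w\<^sub>0 w\<^sub>1 where "\<not> affine_dependent U" "affine hull U = UNIV" "card U = DIM('a) + 1" "finite U"
    "W = insert w\<^sub>0 (insert w\<^sub>1 U)" "w\<^sub>0 \<notin> insert w\<^sub>1 U" "w\<^sub>1 \<notin> U"
proof -
  obtain U where U: "U \<subseteq> W" "\<not> affine_dependent U" "affine hull U = UNIV"
    using affine_basis_exists[of W] assms(3) by auto
  have fin: "finite U" using U(1) assms(1) by (rule finite_subset)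
  have "int (card U) - 1 = int (DIM('a))"
    using aff_dim_affine_independent[OF U(2)] aff_dim_affine_hull[of U] U(3) by simp
  then have cU: "card U = DIM('a) + 1" by linarith
  have "card (W - U) = 2" using card_Diff_subset[OF fin U(1)] assms(2) cU by simp
  then obtain w\<^sub>0 w\<^sub>1 where w: "W - U = {w\<^sub>0, w\<^sub>1}" "w\<^sub>0 \<noteq> w\<^sub>1" by (auto simp: card_2_iff)
  then have "W = insert w\<^sub>0 (insert w\<^sub>1 U)" "w\<^sub>0 \<notin> insert w\<^sub>1 U" "w\<^sub>1 \<notin> U" using U(1) by blast+
  with U fin cU that show ?thesis by blast
qed

text \<open>The critical points of \<open>(w\<^sub>1 - w\<^sub>0) \<bullet> ln z\<close> on the zero set inject into the zeros of \<open>gale_fun\<close>. If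
that function vanishes identically, the realising curve lies in the zero set and passes through all
critical points, so it lies in every compact component.\<close>

lemma compact_components_bound:
  fixes f :: "'n::finite rpoly"
  assumes n: "2 \<le> CARD('n)"
    and card_keys: "card (Poly_Mapping.keys f) = CARD('n) + 3"
    and full: "affine hull (Poly_Mapping.keys f) = UNIV"
    and smooth: "smooth_zero_set f"
  shows "finite (compact_components f) \<and> 2 * card (compact_components f) \<le> 5 * CARD('n) - 2"
proof -
  obtain U w\<^sub>0 w\<^sub>1 where ind: "\<not> affine_dependent U" and fullU: "affine hull U = UNIV"
    and cU: "card U = CARD('n) + 1" and finU: "finite U"
    and W: "Poly_Mapping.keys f = insert w\<^sub>0 (insert w\<^sub>1 U)" "w\<^sub>0 \<notin> insert w\<^sub>1 U" "w\<^sub>1 \<notin> U"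
    using affine_basis_with_two_more[of "Poly_Mapping.keys f"] card_keys full by auto
  have bary: "\<exists>\<mu>. (\<Sum>u\<in>U. \<mu> u) = 1 \<and> (\<Sum>u\<in>U. \<mu> u *\<^sub>R u) = w" for w
  proof -
    have "w \<in> affine hull U" using fullU by simp
    then show ?thesis unfolding affine_hull_finite[OF finU] by simp
  qed
  obtain \<mu>\<^sub>0 where \<mu>\<^sub>0: "(\<Sum>u\<in>U. \<mu>\<^sub>0 u) = 1" "(\<Sum>u\<in>U. \<mu>\<^sub>0 u *\<^sub>R u) = w\<^sub>0" using bary by blast
  obtain \<mu>\<^sub>1 where \<mu>\<^sub>1: "(\<Sum>u\<in>U. \<mu>\<^sub>1 u) = 1" "(\<Sum>u\<in>U. \<mu>\<^sub>1 u *\<^sub>R u) = w\<^sub>1" using bary by blast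
  obtain u\<^sub>0 where u0: "u\<^sub>0 \<in> U" "\<mu>\<^sub>0 u\<^sub>0 \<noteq> 0"
    using \<mu>\<^sub>0(1) by (metis sum.neutral zero_neq_one)
  define c where "c = Poly_Mapping.lookup f"
  interpret two_extra_exponents U u\<^sub>0 w\<^sub>0 w\<^sub>1 \<mu>\<^sub>0 \<mu>\<^sub>1 c "c w\<^sub>0" "c w\<^sub>1"
    by unfold_locales
       (use finU ind fullU cU n u0 W \<mu>\<^sub>0 \<mu>\<^sub>1 in \<open>auto simp: c_def simp flip: in_keys_iff\<close>)
  define K where "K z = (\<chi> i. (w\<^sub>1 - w\<^sub>0) $ i / z $ i)" for z :: "real^'n"
  have zs: "zero_set f = {z \<in> pos_orthant. rp_eval f z = 0}" by (simp add: zero_set_def)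
  have cc: "compact_components f = {C \<in> components {z \<in> pos_orthant. rp_eval f z = 0}. compact C}"
    by (simp add: compact_components_def zs)
  have G0: "rp_gradient f z \<noteq> 0" if "z \<in> pos_orthant" "rp_eval f z = 0" for z
    using smooth rp_eval_has_gradient[OF that(1), of f] that by (auto simp: smooth_zero_set_def zs)
  have \<xi>0: "w\<^sub>1 - w\<^sub>0 \<noteq> 0" using W(2) by auto
  have sum_keys: "(\<Sum>w\<in>Poly_Mapping.keys f. g w) = (\<Sum>u\<in>U. g u) + g w\<^sub>0 + g w\<^sub>1"
    for g :: "real^'n \<Rightarrow> 'b::ab_group_add"
    using W finU by (simp add: add_ac)
  have eval: "rp_eval f z = exp_sum (log_coords z)" if "z \<in> pos_orthant" for z
    unfolding rp_eval_def sum_keys exp_sum_def by (simp add: monom_at_exp[OF that] c_def)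
  have crit: "exp_sum (log_coords z) = 0 \<and> (\<exists>\<tau>. exp_grad (log_coords z) = \<tau> *\<^sub>R (w\<^sub>1 - w\<^sub>0))"
    if "z \<in> pos_orthant" "rp_eval f z = 0" "K z = k *\<^sub>R rp_gradient f z" for z k
    using rp_gradient_parallel[OF that(1) \<xi>0 that(3)[unfolded K_def]] eval[OF that(1)] that(2)
    unfolding sum_keys exp_grad_def by (simp add: monom_at_exp[OF that(1)] c_def)
  note geometry = open_pos_orthant G0 rp_eval_has_gradient continuous_on_rp_gradient
    log_linear_has_gradient[of _ "w\<^sub>1 - w\<^sub>0", folded K_def]
  show ?thesis
  proof (cases "\<exists>t\<in>region. gale_fun t \<noteq> 0")
    case True
    define X where "X = {z \<in> pos_orthant. rp_eval f z = 0 \<and> (\<exists>k. K z = k *\<^sub>R rp_gradient f z)}"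
    define Y where "Y = {x. exp_sum x = 0 \<and> (\<exists>\<tau>. exp_grad x = \<tau> *\<^sub>R (w\<^sub>1 - w\<^sub>0))}"
    have Y: "finite Y" "card Y \<le> 5 * CARD('n) - 2"
      using card_critical_le[OF True] by (auto simp: Y_def card_J cU)
    have inj: "inj_on log_coords X" using log_coords_inj by (auto simp: X_def intro: inj_onI)
    have sub: "log_coords ` X \<subseteq> Y" using crit by (auto simp: X_def Y_def)
    have "finite X" "card X \<le> card Y"
      using inj_on_finite[OF inj sub Y(1)] card_inj_on_le[OF inj sub Y(1)] by auto
    moreover have "finite (compact_components f) \<and> 2 * card (compact_components f) \<le> card X"
      unfolding cc X_def
      by (rule card_compact_components_le[OF _ geometry]) (use n \<open>finite X\<close> in \<open>auto simp: X_def\<close>)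
    ultimately show ?thesis using Y by linarith
  next
    case False
    have "compact_components f = {}"
    proof (rule ccontr)
      assume "compact_components f \<noteq> {}"
      then obtain C where C: "C \<in> components {z \<in> pos_orthant. rp_eval f z = 0}" "compact C"
        by (auto simp: cc)
      have Csub: "C \<subseteq> {z \<in> pos_orthant. rp_eval f z = 0}" using in_components_subset[OF C(1)] .
      obtain p k where p: "p \<in> C" "K p = k *\<^sub>R rp_gradient f p"
        using compact_component_has_critical_point[OF geometry C] by blast
      have pV: "p \<in> pos_orthant" "rp_eval f p = 0" using p Csub by auto
      obtain t\<^sub>0 where t0: "realises (log_coords p) t\<^sub>0"
        using crit[OF pV p(2)] critical_realises by blast
      obtain \<xi> where \<xi>: "continuous_on region \<xi>" "\<And>t. t \<in> region \<Longrightarrow> realises (\<xi> t) t"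
        using realising_curve by blast
      define \<gamma> where "\<gamma> t = (\<chi> i. exp (\<xi> t $ i))" for t
      have \<gamma>pos: "\<gamma> t \<in> pos_orthant" for t by (simp add: \<gamma>_def pos_orthant_def)
      have log\<gamma>: "log_coords (\<gamma> t) = \<xi> t" for t by (simp add: \<gamma>_def log_coords_def)
      have \<gamma>V: "rp_eval f (\<gamma> t) = 0" if "t \<in> region" for t
        using realises_zero[OF \<xi>(2)[OF that]] False that by (simp add: eval[OF \<gamma>pos] log\<gamma>)
      have "connected (\<gamma> ` region)"
        unfolding \<gamma>_def
        by (intro connected_continuous_image convex_connected convex_region continuous_intros \<xi>(1))
      moreover have "\<gamma> ` region \<subseteq> {z \<in> pos_orthant. rp_eval f z = 0}" using \<gamma>pos \<gamma>V by auto
      moreover have t0r: "t\<^sub>0 \<in> region" using realises_region[OF t0] .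
      moreover have "\<gamma> t\<^sub>0 = p"
        using realises_unique[OF \<xi>(2)[OF t0r] t0] log_coords_inj[OF \<gamma>pos pV(1)] by (simp add: log\<gamma>)
      ultimately have \<gamma>C: "\<gamma> ` region \<subseteq> C"
        using components_maximal[OF C(1), of "\<gamma> ` region"] p(1) by blast
      \<comment> \<open>along the curve the monomial with exponent u - u0 is the affine form of u\<close>
      have "\<exists>\<delta>>0. \<forall>z\<in>C. \<delta> \<le> monom_at (u - u\<^sub>0) z" for u
      proof -
        have "continuous_on C (monom_at (u - u\<^sub>0))"
          by (rule continuous_on_subset[OF continuous_on_monom_at]) (use Csub in auto)
        then obtain q where q: "q \<in> C" "\<forall>z\<in>C. monom_at (u - u\<^sub>0) q \<le> monom_at (u - u\<^sub>0) z"
          using continuous_attains_inf[OF C(2)] p(1) by blast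
        moreover have "0 < monom_at (u - u\<^sub>0) q"
          using q(1) Csub by (subst monom_at_exp) auto
        ultimately show ?thesis by blast
      qed
      then obtain \<delta> where \<delta>: "\<And>u. 0 < \<delta> u" "\<And>u z. z \<in> C \<Longrightarrow> \<delta> u \<le> monom_at (u - u\<^sub>0) z"
        by metis
      show False
      proof (rule forms_not_bounded_below[of \<delta>])
        show "region \<noteq> {}" using t0r by blast
        show "0 < \<delta> u" for u by (rule \<delta>(1))
        fix u t assume u: "u \<in> J" and t: "t \<in> region"
        have "\<delta> u \<le> monom_at (u - u\<^sub>0) (\<gamma> t)" using \<delta>(2) \<gamma>C t by blast
        also have "\<dots> = form u t"
          using \<xi>(2)[OF t] u by (simp add: monom_at_exp[OF \<gamma>pos] log\<gamma> realises_def)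
        finally show "\<delta> u \<le> form u t" .
      qed
    qed
    then show ?thesis by simp
  qed
qed


section \<open>Faces of polygons in projective charts\<close>

lemma aff_dim_in_hyperplane:
  fixes F :: "'a::euclidean_space set"
  assumes "\<And>x. x \<in> F \<Longrightarrow> u \<bullet> x = 1"
  shows "aff_dim F = int (dim F) - 1"
proof -
  have "affine hull F \<subseteq> {x. u \<bullet> x = 1}"
    using assms by (intro hull_minimal affine_hyperplane) auto
  then have "0 \<notin> affine hull F" by auto
  then have "aff_dim (insert 0 F) = aff_dim F + 1" by (simp add: aff_dim_insert)
  moreover have "aff_dim (insert 0 F) = int (dim (insert 0 F))"
    by (intro aff_dim_zero) (simp add: hull_inc)
  ultimately show ?thesis by (simp add: dim_insert span_0)
qed

lemma central_projection_segment:
  fixes y\<^sub>1 y\<^sub>2 z u :: "'a::euclidean_space"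
  assumes sign: "0 < (u \<bullet> y\<^sub>1) * (u \<bullet> y\<^sub>2)" and z: "z \<in> closed_segment y\<^sub>1 y\<^sub>2"
  shows "z /\<^sub>R (u \<bullet> z) \<in> closed_segment (y\<^sub>1 /\<^sub>R (u \<bullet> y\<^sub>1)) (y\<^sub>2 /\<^sub>R (u \<bullet> y\<^sub>2))"
proof -
  obtain s where s: "0 \<le> s" "s \<le> 1" "z = (1 - s) *\<^sub>R y\<^sub>1 + s *\<^sub>R y\<^sub>2" using z by (auto simp: in_segment)
  define a b where "a = u \<bullet> y\<^sub>1" and "b = u \<bullet> y\<^sub>2"
  have ab: "0 < a * b" "a \<noteq> 0" "b \<noteq> 0" using sign by (auto simp: a_def b_def)
  have uz: "u \<bullet> z = (1 - s) * a + s * b" by (simp add: s a_def b_def inner_add_right)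
  define r where "r = s * b / (u \<bullet> z)"
  consider (pos) "0 < a" "0 < b" | (neg) "a < 0" "b < 0" using ab(1) by (auto simp: zero_less_mult_iff)
  then have "u \<bullet> z \<noteq> 0 \<and> 0 \<le> r \<and> 0 \<le> (1 - s) * a / (u \<bullet> z)"
  proof cases
    case pos
    have "0 < u \<bullet> z" unfolding uz
      using s(1,2) pos by (cases "s = 0") (auto intro!: add_nonneg_pos)
    then show ?thesis using pos s(1,2) by (simp add: r_def)
  next
    case neg
    have "u \<bullet> z < 0" unfolding uz
      using s(1,2) neg by (cases "s = 0") (auto intro!: add_nonpos_neg simp: mult_nonneg_nonpos mult_pos_neg)
    then show ?thesis using neg s(1,2) by (simp add: r_def divide_nonpos_neg mult_nonneg_nonpos)
  qed
  then have nz: "u \<bullet> z \<noteq> 0" and r: "0 \<le> r" "0 \<le> (1 - s) * a / (u \<bullet> z)" by blast+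
  have r1: "1 - r = (1 - s) * a / (u \<bullet> z)"
  proof -
    have "1 - r = (u \<bullet> z - s * b) / (u \<bullet> z)" using nz by (simp add: r_def diff_divide_distrib)
    then show ?thesis by (simp add: uz)
  qed
  have "0 \<le> r" "r \<le> 1" using r r1 by linarith+
  moreover have "z /\<^sub>R (u \<bullet> z) = (1 - r) *\<^sub>R (y\<^sub>1 /\<^sub>R a) + r *\<^sub>R (y\<^sub>2 /\<^sub>R b)"
  proof -
    have "(1 - r) / a = (1 - s) / (u \<bullet> z)" "r / b = s / (u \<bullet> z)" using ab r1 by (simp_all add: r_def)
    then have "(1 - r) *\<^sub>R (y\<^sub>1 /\<^sub>R a) + r *\<^sub>R (y\<^sub>2 /\<^sub>R b)
        = ((1 - s) / (u \<bullet> z)) *\<^sub>R y\<^sub>1 + (s / (u \<bullet> z)) *\<^sub>R y\<^sub>2"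
      by (simp only: scaleR_scaleR divide_inverse[symmetric])
    also have "\<dots> = z /\<^sub>R (u \<bullet> z)"
      by (subst (3) s(3)) (simp add: scaleR_add_right divide_inverse mult.commute)
    finally show ?thesis by simp
  qed
  ultimately show "z /\<^sub>R (u \<bullet> z) \<in> closed_segment (y\<^sub>1 /\<^sub>R (u \<bullet> y\<^sub>1)) (y\<^sub>2 /\<^sub>R (u \<bullet> y\<^sub>2))"
    unfolding in_segment a_def b_def by blast
qed

lemma convex_nonvanishing_sign:
  fixes T :: "'a::euclidean_space set"
  assumes "convex T" "\<And>x. x \<in> T \<Longrightarrow> u \<bullet> x \<noteq> 0" "x \<in> T" "y \<in> T"
  shows "0 < (u \<bullet> x) * (u \<bullet> y)"
proof (rule ccontr)
  assume "\<not> ?thesis"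
  then have mixed: "u \<bullet> x \<le> 0 \<and> 0 \<le> u \<bullet> y \<or> u \<bullet> y \<le> 0 \<and> 0 \<le> u \<bullet> x"
    by (auto simp: not_less mult_le_0_iff)
  have conn: "connected ((\<lambda>z. u \<bullet> z) ` T)"
    by (intro connected_continuous_image convex_connected assms continuous_intros)
  have "u \<bullet> x \<in> (\<lambda>z. u \<bullet> z) ` T" "u \<bullet> y \<in> (\<lambda>z. u \<bullet> z) ` T" using assms(3,4) by auto
  then have "0 \<in> (\<lambda>z. u \<bullet> z) ` T"
    using mixed connectedD_interval[OF conn] by blast
  then show False using assms(2) by auto
qed

text \<open>Two charts of the same projective set are related by central projection from 0. It preserves segments
because a chart is convex and never meets the hyperplane that is at infinity for the other chart, so
the scaling factors have constant sign. Hence it preserves faces; it also preserves linear spans,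
which determine dimensions.\<close>

lemma proj_faces_in_chart:
  fixes S :: "'a::euclidean_space set set"
  assumes T\<^sub>0: "convex T\<^sub>0" "\<And>x. x \<in> T\<^sub>0 \<Longrightarrow> u\<^sub>0 \<bullet> x = 1" and S: "S = (\<lambda>x. span {x}) ` T\<^sub>0"
  shows "proj_faces j S \<subseteq> (\<lambda>F. (\<lambda>x. span {x}) ` F) ` {F. F face_of T\<^sub>0 \<and> aff_dim F = int j}"
proof
  fix F' assume "F' \<in> proj_faces j S"
  then obtain F T u where F': "F' = (\<lambda>x. span {x}) ` F" and F: "F face_of T" "aff_dim F = int j"
    and T: "polytope T" "\<And>x. x \<in> T \<Longrightarrow> u \<bullet> x = 1" and ST: "S = (\<lambda>x. span {x}) ` T"
    unfolding proj_faces_def chart_polytope_def by blast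
  have "convex T" using T(1) by (rule polytope_imp_convex)
  have FT: "F \<subseteq> T" using F(1) by (rule face_of_imp_subset)
  \<comment> \<open>the central projections between the two charts\<close>
  define \<phi> where "\<phi> x = x /\<^sub>R (u\<^sub>0 \<bullet> x)" for x
  define \<psi> where "\<psi> x = x /\<^sub>R (u \<bullet> x)" for x
  have same_line: "y = x /\<^sub>R (v \<bullet> x) \<and> v \<bullet> x \<noteq> 0"
    if "span {x} = span {y}" "v \<bullet> y = 1" "x \<noteq> 0" for x y v :: 'a
  proof -
    have "x \<in> span {y}" using that(1) span_base[of x "{x}"] by simp
    then obtain k where "x = k *\<^sub>R y" by (auto simp: span_singleton)
    then show ?thesis using that(2,3) by simp
  qed
  have nz: "x \<noteq> 0" if "x \<in> T \<or> x \<in> T\<^sub>0" for x using that T(2)[of x] T\<^sub>0(2)[of x] by auto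
  have \<phi>: "\<phi> x \<in> T\<^sub>0 \<and> u\<^sub>0 \<bullet> x \<noteq> 0" if "x \<in> T" for x
  proof -
    have "span {x} \<in> (\<lambda>x. span {x}) ` T\<^sub>0" using that S ST by blast
    then obtain y where "y \<in> T\<^sub>0" "span {x} = span {y}" by auto
    then show ?thesis using same_line[of x y u\<^sub>0] T\<^sub>0(2) nz that by (simp add: \<phi>_def)
  qed
  have \<psi>: "\<psi> y \<in> T \<and> u \<bullet> y \<noteq> 0" if "y \<in> T\<^sub>0" for y
  proof -
    have "span {y} \<in> (\<lambda>x. span {x}) ` T" using that S ST by blast
    then obtain x where "x \<in> T" "span {y} = span {x}" by auto
    then show ?thesis using same_line[of y x u] T(2) nz that by (simp add: \<psi>_def)
  qed
  have \<psi>\<phi>: "\<psi> (\<phi> x) = x" if "x \<in> T" for x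
    using \<phi>[OF that] T(2)[OF that] by (simp add: \<phi>_def \<psi>_def)
  have \<phi>\<psi>: "\<phi> (\<psi> y) = y" if "y \<in> T\<^sub>0" for y
    using \<psi>[OF that] T\<^sub>0(2)[OF that] by (simp add: \<phi>_def \<psi>_def)
  have seg: "\<psi> z \<in> closed_segment (\<psi> a) (\<psi> b)" if "a \<in> T\<^sub>0" "b \<in> T\<^sub>0" "z \<in> closed_segment a b" for a b z
  proof -
    have "0 < (u \<bullet> a) * (u \<bullet> b)"
      using convex_nonvanishing_sign[OF T\<^sub>0(1), of u a b] \<psi> that(1,2) by blast
    then show ?thesis unfolding \<psi>_def using that(3) by (rule central_projection_segment)
  qed
  define F\<^sub>0 where "F\<^sub>0 = \<phi> ` F"
  have sub: "F\<^sub>0 \<subseteq> T\<^sub>0" using FT \<phi> by (auto simp: F\<^sub>0_def)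
  have inF: "y \<in> F\<^sub>0 \<longleftrightarrow> \<psi> y \<in> F" if "y \<in> T\<^sub>0" for y
  proof
    assume "y \<in> F\<^sub>0"
    then obtain x where "x \<in> F" "y = \<phi> x" by (auto simp: F\<^sub>0_def)
    then show "\<psi> y \<in> F" using \<psi>\<phi>[of x] FT by auto
  next
    assume "\<psi> y \<in> F"
    then have "\<phi> (\<psi> y) \<in> F\<^sub>0" by (simp add: F\<^sub>0_def)
    then show "y \<in> F\<^sub>0" using \<phi>\<psi>[OF that] by simp
  qed
  have "F\<^sub>0 face_of T\<^sub>0"
    unfolding face_of_def
  proof (intro conjI ballI impI)
    show "F\<^sub>0 \<subseteq> T\<^sub>0" by (rule sub)
    show "convex F\<^sub>0"
      unfolding convex_contains_segment
    proof (intro ballI subsetI)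
      fix a b z assume ab: "a \<in> F\<^sub>0" "b \<in> F\<^sub>0" "z \<in> closed_segment a b"
      have zT: "z \<in> T\<^sub>0" using ab sub T\<^sub>0(1) by (meson closed_segment_subset subsetD)
      have "closed_segment (\<psi> a) (\<psi> b) \<subseteq> F"
        using ab inF sub face_of_imp_convex[OF F(1)] by (intro closed_segment_subset) auto
      then show "z \<in> F\<^sub>0" using seg[of a b z] ab sub inF[OF zT] by auto
    qed
    fix a b x assume ab: "a \<in> T\<^sub>0" "b \<in> T\<^sub>0" and x: "x \<in> F\<^sub>0" "x \<in> open_segment a b"
    have xT: "x \<in> T\<^sub>0" using x sub by auto
    have inj: "\<psi> x \<noteq> \<psi> a" "\<psi> x \<noteq> \<psi> b"
      using \<phi>\<psi>[OF xT] \<phi>\<psi>[OF ab(1)] \<phi>\<psi>[OF ab(2)] x(2) by (auto simp: open_segment_def)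
    have "\<psi> x \<in> open_segment (\<psi> a) (\<psi> b)"
      using seg[OF ab, of x] x(2) inj by (auto simp: open_segment_def)
    moreover have "\<psi> x \<in> F" using inF[OF xT] x by simp
    ultimately have "\<psi> a \<in> F \<and> \<psi> b \<in> F"
      using F(1) \<psi>[OF ab(1)] \<psi>[OF ab(2)] unfolding face_of_def by blast
    then show "a \<in> F\<^sub>0" "b \<in> F\<^sub>0" using inF ab by auto
  qed
  moreover have line: "span {\<phi> x} = span {x}" if "x \<in> F" for x
  proof -
    have "u\<^sub>0 \<bullet> x \<noteq> 0" using \<phi> FT that by blast
    then have "x = (u\<^sub>0 \<bullet> x) *\<^sub>R \<phi> x" by (simp add: \<phi>_def)
    moreover have "(u\<^sub>0 \<bullet> x) *\<^sub>R \<phi> x \<in> span {\<phi> x}" by (intro span_mul span_base) simp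
    ultimately have "x \<in> span {\<phi> x}" by metis
    moreover have "\<phi> x \<in> span {x}" unfolding \<phi>_def by (intro span_mul span_base) simp
    ultimately show ?thesis unfolding span_eq by simp
  qed
  moreover have "aff_dim F\<^sub>0 = int j"
  proof -
    have "span F\<^sub>0 = span F"
      unfolding span_eq
    proof
      show "F\<^sub>0 \<subseteq> span F"
        unfolding F\<^sub>0_def \<phi>_def by (auto intro: span_mul span_base)
      show "F \<subseteq> span F\<^sub>0"
      proof
        fix x assume "x \<in> F"
        then have "x \<in> span {\<phi> x}" using line span_base[of x "{x}"] by simp
        also have "span {\<phi> x} \<subseteq> span F\<^sub>0" using \<open>x \<in> F\<close> by (intro span_mono) (simp add: F\<^sub>0_def)
        finally show "x \<in> span F\<^sub>0" .
      qed
    qed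
    then have "dim F\<^sub>0 = dim F" by (metis dim_span)
    then show ?thesis
      using F(2) aff_dim_in_hyperplane[of F u, OF T(2)[OF subsetD[OF FT]]]
        aff_dim_in_hyperplane[of F\<^sub>0 u\<^sub>0, OF T\<^sub>0(2)[OF subsetD[OF sub]]] by simp
  qed
  moreover have "F' = (\<lambda>x. span {x}) ` F\<^sub>0"
    using line by (auto simp: F' F\<^sub>0_def image_image)
  ultimately show "F' \<in> (\<lambda>F. (\<lambda>x. span {x}) ` F) ` {F. F face_of T\<^sub>0 \<and> aff_dim F = int j}"
    by blast
qed

text \<open>A polygon in the affine plane \<open>u \<bullet> x = 1\<close> of a three-dimensional space, cut out by linear forms
(represented by vectors) that have a common positive point. Some of the forms may be redundant, so a
\<open>side\<close> may be a point or empty.\<close>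

locale plane_polygon =
  fixes u :: "'a::euclidean_space" and \<Lambda> :: "'a set" and T :: "'a set"
  assumes dim3: "DIM('a) = 3" and u: "u \<noteq> 0" and finite_\<Lambda>: "finite \<Lambda>"
    and T: "T = {x. u \<bullet> x = 1 \<and> (\<forall>l\<in>\<Lambda>. 0 \<le> l \<bullet> x)}"
    and bounded: "bounded T"
    and interior_point: "\<exists>x. u \<bullet> x = 1 \<and> (\<forall>l\<in>\<Lambda>. 0 < l \<bullet> x)"
begin

definition side :: "'a \<Rightarrow> 'a set" where "side l = T \<inter> {x. l \<bullet> x = 0}"

lemma polytope_T: "polytope T"
proof -
  have eq: "T = {x. u \<bullet> x = 1} \<inter> (\<Inter>l\<in>\<Lambda>. {x. l \<bullet> x \<ge> 0})" by (auto simp: T)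
  have "polyhedron T"
    unfolding eq using finite_\<Lambda>
    by (intro polyhedron_Int polyhedron_hyperplane polyhedron_Inter) (auto simp: polyhedron_halfspace_ge)
  then show ?thesis using bounded by (simp add: polytope_eq_bounded_polyhedron)
qed

lemma convex_T: "convex T" using polytope_T by (rule polytope_imp_convex)

lemma open_strict: "open {x. \<forall>l\<in>\<Lambda>'. 0 < l \<bullet> x}" if "\<Lambda>' \<subseteq> \<Lambda>"
proof -
  have eq: "{x. \<forall>l\<in>\<Lambda>'. 0 < l \<bullet> x} = (\<Inter>l\<in>\<Lambda>'. {x. 0 < l \<bullet> x})" by auto
  show ?thesis
    unfolding eq using finite_\<Lambda> that by (intro open_INT ballI open_Collect_less continuous_intros) (rule finite_subset)
qed

lemma aff_dim_T: "aff_dim T = 2"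
proof -
  let ?H = "{x. u \<bullet> x = 1}" and ?O = "{x. \<forall>l\<in>\<Lambda>. 0 < l \<bullet> x}"
  have H: "aff_dim ?H = 2" using u dim3 by (simp add: aff_dim_hyperplane)
  have "?H \<inter> ?O \<noteq> {}" using interior_point by auto
  then have "aff_dim (?H \<inter> ?O) = 2"
    using aff_dim_convex_Int_open[of ?H ?O] open_strict[of \<Lambda>] H by (simp add: convex_hyperplane)
  moreover have "?H \<inter> ?O \<subseteq> T" "T \<subseteq> ?H" by (auto simp: T less_imp_le)
  ultimately show ?thesis using aff_dim_subset[of "?H \<inter> ?O" T] aff_dim_subset[of T ?H] H by simp
qed

lemma side_face: "l \<in> \<Lambda> \<Longrightarrow> side l face_of T"
  unfolding side_def by (intro face_of_Int_supporting_hyperplane_ge convex_T) (auto simp: T)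

lemma aff_dim_side: "l \<in> \<Lambda> \<Longrightarrow> aff_dim (side l) \<le> 1"
proof -
  assume l: "l \<in> \<Lambda>"
  obtain x where "u \<bullet> x = 1" "\<forall>l\<in>\<Lambda>. 0 < l \<bullet> x" using interior_point by blast
  then have "x \<in> T" "l \<bullet> x \<noteq> 0" using l by (auto simp: T less_imp_le)
  then have "x \<in> T" "x \<notin> side l" by (auto simp: side_def)
  then show ?thesis
    using face_of_aff_dim_lt[OF convex_T side_face[OF l]] aff_dim_T by fastforce
qed

lemma edge_in_side:
  assumes F: "F face_of T" "aff_dim F = 1" and l: "l \<in> \<Lambda>" "F \<subseteq> side l"
  shows "F = side l"
proof (rule ccontr)
  assume "F \<noteq> side l"
  moreover have "side l \<subseteq> T" by (auto simp: side_def)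
  then have "F face_of side l" using face_of_subset[OF F(1) l(2)] by blast
  moreover have "convex (side l)" using face_of_imp_convex[OF side_face[OF l(1)]] .
  ultimately have "aff_dim F < aff_dim (side l)" by (intro face_of_aff_dim_lt)
  then show False using aff_dim_side[OF l(1)] F(2) by simp
qed

text \<open>A relative interior point of the edge is not interior to the polygon, so some form vanishes there. A
form that is nonnegative on the edge and vanishes at such a point vanishes on the whole edge.\<close>

lemma edge_is_side:
  assumes F: "F face_of T" "aff_dim F = 1"
  shows "\<exists>l\<in>\<Lambda>. F = side l"
proof -
  have "F \<noteq> {}" using F(2) by auto
  then obtain x where x: "x \<in> rel_interior F"
    using rel_interior_eq_empty[OF face_of_imp_convex[OF F(1)]] by blast
  have xT: "x \<in> T" using x rel_interior_subset face_of_imp_subset[OF F(1)] by blast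
  have "\<exists>l\<in>\<Lambda>. l \<bullet> x = 0"
  proof (rule ccontr)
    assume "\<not> ?thesis"
    then have pos: "x \<in> {x. \<forall>l\<in>\<Lambda>. 0 < l \<bullet> x}" using xT by (force simp: T)
    have "affine hull T \<subseteq> {x. u \<bullet> x = 1}"
      by (intro hull_minimal affine_hyperplane) (auto simp: T)
    then have "{x. \<forall>l\<in>\<Lambda>. 0 < l \<bullet> x} \<inter> affine hull T \<subseteq> T" by (auto simp: T less_imp_le)
    then have "x \<in> rel_interior T"
      using pos xT open_strict[of \<Lambda>] unfolding mem_rel_interior by blast
    moreover have "F \<noteq> T" using F(2) aff_dim_T by auto
    then have "F \<inter> rel_interior T = {}" using face_of_disjoint_rel_interior[OF F(1)] by blast
    ultimately show False using x rel_interior_subset by blast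
  qed
  then obtain l where l: "l \<in> \<Lambda>" "x \<in> side l" using xT by (auto simp: side_def)
  then have "F \<subseteq> side l"
    using subset_of_face_of[OF side_face[OF l(1)] face_of_imp_subset[OF F(1)]] x by blast
  then show ?thesis using edge_in_side[OF F l(1)] l(1) by blast
qed

lemma extreme_points_on_side:
  assumes "l \<in> \<Lambda>"
  shows "card {x \<in> side l. x extreme_point_of T} \<le> 2"
proof -
  have "\<exists>p q. {x \<in> side l. x extreme_point_of T} \<subseteq> {p, q}"
  proof (cases "side l = {}")
    case False
    have "compact (side l)"
      using face_of_polytope_polytope[OF polytope_T side_face[OF assms]] polytope_imp_compact by blast
    moreover have "convex (side l)" using face_of_imp_convex[OF side_face[OF assms]] .
    moreover have "collinear (side l)" using aff_dim_side[OF assms] by (simp add: collinear_aff_dim)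
    ultimately obtain p q where pq: "side l = closed_segment p q"
      using compact_convex_collinear_segment False by blast
    have "p \<in> T" "q \<in> T" using pq by (auto simp: side_def)
    then have "{x \<in> side l. x extreme_point_of T} \<subseteq> {p, q}"
      unfolding pq extreme_point_of_def by (auto simp: open_segment_def)
    then show ?thesis by blast
  qed auto
  then obtain p q where pq: "{x \<in> side l. x extreme_point_of T} \<subseteq> {p, q}" by blast
  have "card {x \<in> side l. x extreme_point_of T} \<le> card {p, q}" using pq by (intro card_mono) auto
  also have "\<dots> \<le> 2" by (simp add: card_insert_if)
  finally show "card {x \<in> side l. x extreme_point_of T} \<le> 2" .
qed

text \<open>Within the plane \<open>u \<bullet> x = 1\<close> of a three-dimensional space a single form still leaves a direction in which
it is constant. A point where at most one form vanishes can be moved both ways in that direction.\<close>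

lemma extreme_point_on_two_sides:
  assumes x: "x extreme_point_of T"
  shows "2 \<le> card {l \<in> \<Lambda>. x \<in> side l}"
proof (rule ccontr)
  assume "\<not> ?thesis"
  then have "\<forall>l\<in>{l \<in> \<Lambda>. x \<in> side l}. \<forall>l'\<in>{l \<in> \<Lambda>. x \<in> side l}. l = l'"
    using finite_\<Lambda> by (subst card_le_Suc0_iff_eq[symmetric]) auto
  \<comment> \<open>k is arbitrary if no form vanishes at x\<close>
  then obtain k where k: "{l \<in> \<Lambda>. x \<in> side l} \<subseteq> {k}" by blast
  have xT: "x \<in> T" using x by (simp add: extreme_point_of_def)
  have "dim {u, k} \<le> 2"
    using dim_le_card'[of "{u, k}"] by (simp add: card_insert_if split: if_splits)
  then have "dim {u, k} < DIM('a)" using dim3 by simp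
  then obtain d where d: "d \<noteq> 0" "\<And>y. y \<in> span {u, k} \<Longrightarrow> orthogonal d y"
    using orthogonal_to_subspace_exists by metis
  have dk: "u \<bullet> d = 0" "k \<bullet> d = 0"
    using d(2)[of u] d(2)[of k] span_base[of _ "{u, k}"] by (auto simp: orthogonal_def inner_commute)
  define N where "N = {y. \<forall>l\<in>\<Lambda> - {k}. 0 < l \<bullet> y}"
  have "0 < l \<bullet> x" if l: "l \<in> \<Lambda> - {k}" for l
  proof -
    have "x \<notin> side l" using l k by blast
    then have "l \<bullet> x \<noteq> 0" using xT by (simp add: side_def)
    moreover have "0 \<le> l \<bullet> x" using xT l unfolding T by blast
    ultimately show ?thesis by simp
  qed
  then have "x \<in> N" by (simp add: N_def)
  moreover have "open N" unfolding N_def by (rule open_strict) auto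
  ultimately obtain r where r: "r > 0" "ball x r \<subseteq> N" by (meson open_contains_ball)
  define e where "e = (r / (2 * norm d)) *\<^sub>R d"
  have e: "e \<noteq> 0" "norm e < r" using r d by (auto simp: e_def)
  have ue: "u \<bullet> e = 0" "k \<bullet> e = 0" using dk by (auto simp: e_def)
  have inT: "x + s *\<^sub>R e \<in> T" if "\<bar>s\<bar> = 1" for s
  proof -
    have "x + s *\<^sub>R e \<in> ball x r" using e that by (simp add: dist_norm)
    then have "x + s *\<^sub>R e \<in> N" using r by blast
    moreover have "k \<bullet> (x + s *\<^sub>R e) = k \<bullet> x" "u \<bullet> (x + s *\<^sub>R e) = u \<bullet> x"
      using ue by (simp_all add: inner_add_right)
    moreover have "u \<bullet> x = 1" "k \<in> \<Lambda> \<Longrightarrow> 0 \<le> k \<bullet> x" using xT unfolding T by blast+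
    ultimately have "u \<bullet> (x + s *\<^sub>R e) = 1" "0 \<le> l \<bullet> (x + s *\<^sub>R e)" if "l \<in> \<Lambda>" for l
      using that by (cases "l = k"; force simp: N_def less_imp_le)+
    then show ?thesis using \<open>u \<bullet> x = 1\<close> ue unfolding T by (simp add: inner_add_right)
  qed
  have "x \<in> open_segment (x + (-1) *\<^sub>R e) (x + 1 *\<^sub>R e)"
  proof -
    have "(x + 1 *\<^sub>R e) - (x + (-1) *\<^sub>R e) = 2 *\<^sub>R e" by (simp add: scaleR_2)
    then have "x + (-1) *\<^sub>R e \<noteq> x + 1 *\<^sub>R e" using e(1) by (metis right_minus_eq scaleR_eq_0_iff zero_neq_numeral)
    moreover have "midpoint (x + (-1) *\<^sub>R e) (x + 1 *\<^sub>R e) = x" by (simp add: midpoint_def scaleR_2[symmetric])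
    ultimately show ?thesis by (metis midpoint_in_open_segment)
  qed
  then show False
    using x inT[of "-1"] inT[of 1] unfolding extreme_point_of_def by auto
qed

text \<open>Double counting of the incidences between vertices and sides.\<close>

lemma card_extreme_points: "finite {x. x extreme_point_of T}" "card {x. x extreme_point_of T} \<le> card \<Lambda>"
proof -
  define V where "V = {x. x extreme_point_of T}"
  show fin: "finite {x. x extreme_point_of T}"
    by (rule finite_polyhedron_extreme_points) (rule polytope_imp_polyhedron[OF polytope_T])
  have "2 * card V = (\<Sum>x\<in>V. 2)" by simp
  also have "\<dots> \<le> (\<Sum>x\<in>V. card {l \<in> \<Lambda>. x \<in> side l})"
    by (intro sum_mono) (simp add: V_def extreme_point_on_two_sides)
  also have "\<dots> = (\<Sum>l\<in>\<Lambda>. card {x \<in> V. x \<in> side l})"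
    using fin finite_\<Lambda> by (intro sum_multicount_gen) (auto simp: V_def)
  also have "\<dots> \<le> (\<Sum>l\<in>\<Lambda>. 2)"
  proof (intro sum_mono)
    fix l assume "l \<in> \<Lambda>"
    moreover have "{x \<in> V. x \<in> side l} = {x \<in> side l. x extreme_point_of T}" by (auto simp: V_def)
    ultimately show "card {x \<in> V. x \<in> side l} \<le> 2" using extreme_points_on_side by simp
  qed
  finally show "card {x. x extreme_point_of T} \<le> card \<Lambda>" by (simp add: V_def)
qed

end


section \<open>The closure of a truncated sector\<close>

lemma inner_real2: "(x::real^2) \<bullet> y = x $ 1 * y $ 1 + x $ 2 * y $ 2"
  by (simp add: inner_vec_def sum_2)

text \<open>On the segment from \<open>(1, 0)\<close> to \<open>(0, 1)\<close>, with parameter \<open>s\<close> for \<open>(s, 1 - s)\<close>, the cone cuts out a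
compact interval \<open>[a, b]\<close>. The two sides are the rays through its end points: \<open>\<alpha>\<close> and \<open>\<beta>\<close> are \<open>s - a\<close>
and \<open>b - s\<close>, made homogeneous.\<close>

lemma plane_cone_two_sides:
  fixes L :: "(real^2) set"
  assumes fin: "finite L" and ax: "axis 1 1 \<in> L" "axis 2 1 \<in> L" and y0: "\<And>l. l \<in> L \<Longrightarrow> 0 < l \<bullet> y\<^sub>0"
  obtains \<alpha> \<beta> :: "real^2" where "\<And>y. (\<forall>l\<in>L. 0 \<le> l \<bullet> y) \<longleftrightarrow> 0 \<le> \<alpha> \<bullet> y \<and> 0 \<le> \<beta> \<bullet> y"
    "0 < \<alpha> \<bullet> y\<^sub>0" "0 < \<beta> \<bullet> y\<^sub>0"
proof -
  define p :: "real \<Rightarrow> real^2" where "p s = vector [s, 1 - s]" for s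
  define \<sigma> :: "real^2 \<Rightarrow> real" where "\<sigma> y = y $ 1 + y $ 2" for y
  define A where "A = {s. \<forall>l\<in>L. 0 \<le> l \<bullet> p s}"
  have lp: "l \<bullet> p s = s * (l $ 1 - l $ 2) + l $ 2" for l s
    by (simp add: inner_real2 p_def algebra_simps)
  have A_eq: "A = (\<Inter>l\<in>L. {s. 0 \<le> s * (l $ 1 - l $ 2) + l $ 2})" by (auto simp: A_def lp)
  have coord: "0 \<le> y $ 1" "0 \<le> y $ 2" if "\<forall>l\<in>L. 0 \<le> l \<bullet> y" for y
    using ax[THEN bspec[OF that]] by (simp_all add: inner_axis')
  have A01: "A \<subseteq> {0..1}"
  proof
    fix s assume "s \<in> A"
    then show "s \<in> {0..1}" using coord[of "p s"] by (simp add: A_def p_def)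
  qed
  have "closed A" unfolding A_eq by (intro closed_INT ballI closed_Collect_le continuous_intros)
  then have "compact A" using A01 bounded_subset[OF bounded_closed_interval] by (auto simp: compact_eq_bounded_closed)
  moreover have "connected A"
    unfolding connected_iff_interval
  proof (intro ballI allI impI)
    fix x y z assume xy: "x \<in> A" "y \<in> A" "x \<le> z" "z \<le> y"
    have "0 \<le> z * k + r" if "0 \<le> x * k + r" "0 \<le> y * k + r" for k r :: real
      using that xy(3,4) by (cases "0 \<le> k") (smt (verit) mult_right_mono mult_right_mono_neg)+
    then show "z \<in> A" using xy(1,2) unfolding A_eq by blast
  qed
  ultimately obtain a b where ab: "A = {a..b}" using connected_compact_interval_1 by blast
  define \<alpha> :: "real^2" where "\<alpha> = vector [1 - a, - a]"
  define \<beta> :: "real^2" where "\<beta> = vector [b - 1, b]"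
  have \<alpha>: "\<alpha> \<bullet> y = y $ 1 - a * \<sigma> y" and \<beta>: "\<beta> \<bullet> y = b * \<sigma> y - y $ 1" for y
    by (simp_all add: \<alpha>_def \<beta>_def inner_real2 \<sigma>_def algebra_simps)
  have ray: "y = \<sigma> y *\<^sub>R p (y $ 1 / \<sigma> y)" if "\<sigma> y \<noteq> 0" for y
    using that by (simp add: vec_eq_iff forall_2 p_def right_diff_distrib) (simp add: \<sigma>_def)
  have in_cone: "(\<forall>l\<in>L. 0 \<le> l \<bullet> y) \<longleftrightarrow> 0 \<le> \<alpha> \<bullet> y \<and> 0 \<le> \<beta> \<bullet> y" if \<sigma>: "0 < \<sigma> y" for y
  proof -
    have "l \<bullet> y = \<sigma> y * (l \<bullet> p (y $ 1 / \<sigma> y))" for l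
      using arg_cong[OF ray[of y], of "\<lambda>v. l \<bullet> v"] \<sigma> by simp
    then have "(\<forall>l\<in>L. 0 \<le> l \<bullet> y) \<longleftrightarrow> y $ 1 / \<sigma> y \<in> A"
      using \<sigma> by (simp add: A_def zero_le_mult_iff)
    also have "\<dots> \<longleftrightarrow> 0 \<le> \<alpha> \<bullet> y \<and> 0 \<le> \<beta> \<bullet> y"
      using \<sigma> by (simp add: ab \<alpha> \<beta> pos_le_divide_eq pos_divide_le_eq)
    finally show ?thesis .
  qed
  have nonneg: "0 \<le> \<alpha> \<bullet> y \<and> 0 \<le> \<beta> \<bullet> y" if y: "\<forall>l\<in>L. 0 \<le> l \<bullet> y" for y
  proof (cases "\<sigma> y = 0")
    case True
    then have "y $ 1 = 0" using coord[OF y] by (simp add: \<sigma>_def)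
    then show ?thesis using True by (simp add: \<alpha> \<beta>)
  next
    case False
    then have "0 < \<sigma> y" using coord[OF y] by (simp add: \<sigma>_def)
    then show ?thesis using in_cone y by blast
  qed
  \<comment> \<open>a nonzero form that is nonnegative on the cone is positive at interior points\<close>
  have strict: "0 < v \<bullet> y\<^sub>0" if v: "\<And>y. \<forall>l\<in>L. 0 \<le> l \<bullet> y \<Longrightarrow> 0 \<le> v \<bullet> y" "v \<noteq> 0" for v
  proof -
    have "open (\<Inter>l\<in>L. {y. 0 < l \<bullet> y})"
      using fin by (intro open_INT ballI open_Collect_less continuous_intros)
    moreover have "y\<^sub>0 \<in> (\<Inter>l\<in>L. {y. 0 < l \<bullet> y})" using y0 by auto
    ultimately obtain r where r: "0 < r" "ball y\<^sub>0 r \<subseteq> (\<Inter>l\<in>L. {y. 0 < l \<bullet> y})"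
      by (meson open_contains_ball)
    define \<epsilon> where "\<epsilon> = r / (2 * norm v)"
    have \<epsilon>: "0 < \<epsilon>" "norm (\<epsilon> *\<^sub>R v) < r" using r v(2) by (auto simp: \<epsilon>_def)
    then have "y\<^sub>0 - \<epsilon> *\<^sub>R v \<in> ball y\<^sub>0 r" by (simp add: dist_norm)
    then have "\<forall>l\<in>L. 0 < l \<bullet> (y\<^sub>0 - \<epsilon> *\<^sub>R v)" using r(2) by blast
    then have "0 \<le> v \<bullet> (y\<^sub>0 - \<epsilon> *\<^sub>R v)" using v(1) by (meson less_imp_le)
    then have "\<epsilon> * (v \<bullet> v) \<le> v \<bullet> y\<^sub>0" by (simp add: inner_diff_right)
    moreover have "0 < \<epsilon> * (v \<bullet> v)" using \<epsilon>(1) v(2) by simp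
    ultimately show ?thesis by linarith
  qed
  have "\<alpha> \<noteq> 0" "\<beta> \<noteq> 0" by (auto simp: \<alpha>_def \<beta>_def vec_eq_iff forall_2)
  then have s: "0 < \<alpha> \<bullet> y\<^sub>0" "0 < \<beta> \<bullet> y\<^sub>0" using strict nonneg by blast+
  have "0 < \<sigma> y\<^sub>0" using y0[OF ax(1)] y0[OF ax(2)] by (simp add: \<sigma>_def inner_axis')
  moreover have "0 < (b - a) * \<sigma> y\<^sub>0" using s by (simp add: \<alpha> \<beta> algebra_simps)
  ultimately have "a < b" by (simp add: zero_less_mult_iff)
  have "\<forall>l\<in>L. 0 \<le> l \<bullet> y" if y: "0 \<le> \<alpha> \<bullet> y \<and> 0 \<le> \<beta> \<bullet> y" for y
  proof -
    have "0 \<le> (b - a) * \<sigma> y" using y by (simp add: \<alpha> \<beta> algebra_simps)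
    then have "0 \<le> \<sigma> y" using \<open>a < b\<close> by (simp add: zero_le_mult_iff)
    show ?thesis
    proof (cases "\<sigma> y = 0")
      case True
      then have "y $ 1 = 0" using y by (simp add: \<alpha> \<beta>)
      then have "y = 0" using True by (simp add: \<sigma>_def vec_eq_iff forall_2)
      then show ?thesis by simp
    next
      case False
      then show ?thesis using \<open>0 \<le> \<sigma> y\<close> in_cone y by simp
    qed
  qed
  with nonneg s that show ?thesis by blast
qed

lemma span_singleton_proj_point: "x \<noteq> 0 \<Longrightarrow> span {x} \<in> proj_points"
  by (simp add: proj_points_def dim_singleton)

lemma span_singleton_scale: "k \<noteq> 0 \<Longrightarrow> span {k *\<^sub>R x} = span {x}" for x :: "'a::real_vector"
proof -
  assume k: "k \<noteq> 0"
  have "k *\<^sub>R x \<in> span {x}" by (intro span_mul span_base) simp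
  moreover have "(1 / k) *\<^sub>R (k *\<^sub>R x) \<in> span {k *\<^sub>R x}" by (intro span_mul span_base) simp
  then have "x \<in> span {k *\<^sub>R x}" using k by simp
  ultimately show ?thesis unfolding span_eq by simp
qed

text \<open>The set where the homogeneous forms in \<open>L\<close> and the affine form \<open>b + \<phi> \<bullet> y\<close> are positive, with a point \<open>y\<^sub>0\<close>
in it. Its homogenisation \<open>lifted_cone\<close> lies in the nonnegative orthant of \<open>\<real> \<times> \<real>\<^sup>2\<close>, so \<open>height\<close>, the sum of
the coordinates, is positive on it away from 0, and the slice \<open>height = 1\<close> is a chart.\<close>

locale truncated_sector =
  fixes L :: "(real^2) set" and b :: real and \<phi> y\<^sub>0 :: "real^2"
  assumes finite_L: "finite L" and axes: "axis 1 1 \<in> L" "axis 2 1 \<in> L" and b: "b \<noteq> 0"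
    and y0: "\<And>l. l \<in> L \<Longrightarrow> 0 < l \<bullet> y\<^sub>0" "0 < b + \<phi> \<bullet> y\<^sub>0"
begin

definition sector :: "(real^2) set" where
  "sector = {y. (\<forall>l\<in>L. 0 < l \<bullet> y) \<and> 0 < b + \<phi> \<bullet> y}"

definition lifted_cone :: "(real \<times> (real^2)) set" where
  "lifted_cone = {x. 0 \<le> fst x \<and> (\<forall>l\<in>L. 0 \<le> l \<bullet> snd x) \<and> 0 \<le> (b, \<phi>) \<bullet> x}"

definition height :: "real \<times> (real^2)" where "height = (1, axis 1 1 + axis 2 1)"

definition chart :: "(real \<times> (real^2)) set" where "chart = {x \<in> lifted_cone. height \<bullet> x = 1}"

lemma height: "height \<bullet> x = fst x + snd x $ 1 + snd x $ 2"
  by (cases x) (simp add: height_def inner_add_left inner_axis')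

lemma lifted_cone_coords:
  assumes "x \<in> lifted_cone" shows "0 \<le> fst x" "0 \<le> snd x $ 1" "0 \<le> snd x $ 2"
proof -
  have "0 \<le> fst x" "0 \<le> axis 1 1 \<bullet> snd x" "0 \<le> axis 2 1 \<bullet> snd x" using assms axes by (auto simp: lifted_cone_def)
  then show "0 \<le> fst x" "0 \<le> snd x $ 1" "0 \<le> snd x $ 2" by (simp_all add: inner_axis')
qed

lemma height_pos:
  assumes "x \<in> lifted_cone" "x \<noteq> 0" shows "0 < height \<bullet> x"
proof (rule ccontr)
  assume "\<not> ?thesis"
  then have "fst x = 0" "snd x $ 1 = 0" "snd x $ 2 = 0" using lifted_cone_coords[OF assms(1)] by (simp_all add: height)
  then have "x = 0" by (simp add: prod_eq_iff vec_eq_iff forall_2)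
  then show False using assms(2) by simp
qed

lemma lifted_cone_scale: "x \<in> lifted_cone \<Longrightarrow> 0 \<le> k \<Longrightarrow> k *\<^sub>R x \<in> lifted_cone"
  by (simp add: lifted_cone_def)

lemma closed_lifted_cone: "closed lifted_cone"
proof -
  have eq: "lifted_cone = {x. 0 \<le> fst x} \<inter> (\<Inter>l\<in>L. {x. 0 \<le> l \<bullet> snd x}) \<inter> {x. 0 \<le> (b, \<phi>) \<bullet> x}"
    by (auto simp: lifted_cone_def)
  show ?thesis
    unfolding eq by (intro closed_Int closed_INT ballI closed_Collect_le continuous_intros)
qed

lemma span_in_chart_iff:
  assumes "x \<noteq> 0"
  shows "span {x} \<in> (\<lambda>x. span {x}) ` chart \<longleftrightarrow> x \<in> lifted_cone \<or> - x \<in> lifted_cone"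
proof
  assume "span {x} \<in> (\<lambda>x. span {x}) ` chart"
  then obtain t where t: "t \<in> lifted_cone" "span {x} = span {t}" by (auto simp: chart_def)
  have "x \<in> span {t}" using t(2) span_base[of x "{x}"] by simp
  then obtain k where "x = k *\<^sub>R t" by (auto simp: span_singleton)
  then show "x \<in> lifted_cone \<or> - x \<in> lifted_cone"
    using lifted_cone_scale[OF t(1), of k] lifted_cone_scale[OF t(1), of "- k"] by (cases "0 \<le> k") auto
next
  have *: "span {y} \<in> (\<lambda>x. span {x}) ` chart" if y: "y \<in> lifted_cone" "y \<noteq> 0" for y
  proof -
    have h: "0 < height \<bullet> y" by (rule height_pos[OF y])
    then have "(1 / (height \<bullet> y)) *\<^sub>R y \<in> chart" using lifted_cone_scale[OF y(1)] by (simp add: chart_def)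
    moreover have "span {(1 / (height \<bullet> y)) *\<^sub>R y} = span {y}" using h by (intro span_singleton_scale) simp
    ultimately show ?thesis by (metis image_eqI)
  qed
  assume "x \<in> lifted_cone \<or> - x \<in> lifted_cone"
  then show "span {x} \<in> (\<lambda>x. span {x}) ` chart"
    using *[of x] *[of "- x"] assms span_singleton_scale[of "-1" x] by auto
qed

lemma chart_nonzero: "x \<in> chart \<Longrightarrow> x \<noteq> 0"
  by (auto simp: chart_def)

text \<open>The span of a vector belongs to a point of the chart exactly if the vector or its negative lies in the
homogenised cone, which is closed. Conversely, moving a point of the chart slightly towards \<open>(1, y\<^sub>0)\<close>
makes all forms positive and the first coordinate nonzero, so it comes from a point of the sector.\<close>

lemma proj_closure_sector: "proj_closure sector = (\<lambda>x. span {x}) ` chart"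
proof
  have sub: "(\<lambda>x. span {x}) ` chart \<subseteq> proj_points"
    using span_singleton_proj_point chart_nonzero by auto
  have "{x. x \<noteq> 0 \<and> span {x} \<in> proj_points - (\<lambda>x. span {x}) ` chart} = - (lifted_cone \<union> uminus ` lifted_cone)"
  proof (intro set_eqI)
    fix x :: "real \<times> (real^2)"
    have "x \<in> uminus ` lifted_cone \<longleftrightarrow> - x \<in> lifted_cone" by (metis (no_types, lifting) image_iff minus_minus)
    moreover have "0 \<in> lifted_cone" by (simp add: lifted_cone_def)
    ultimately show "x \<in> {x. x \<noteq> 0 \<and> span {x} \<in> proj_points - (\<lambda>x. span {x}) ` chart} \<longleftrightarrow> x \<in> - (lifted_cone \<union> uminus ` lifted_cone)"
      using span_in_chart_iff[of x] span_singleton_proj_point[of x] by (cases "x = 0") auto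
  qed
  moreover have "closed (lifted_cone \<union> uminus ` lifted_cone)" using closed_lifted_cone by (intro closed_Un closed_negations) auto
  ultimately have "open {x. x \<noteq> 0 \<and> span {x} \<in> proj_points - (\<lambda>x. span {x}) ` chart}"
    by (simp only: open_Compl)
  then have "openin proj_topology (proj_points - (\<lambda>x. span {x}) ` chart)"
    unfolding openin_proj_topology by blast
  then have "closedin proj_topology ((\<lambda>x. span {x}) ` chart)"
    using sub by (simp add: closedin_def topspace_proj_topology)
  moreover have "proj_embed ` sector \<subseteq> (\<lambda>x. span {x}) ` chart"
  proof (rule image_subsetI)
    fix y assume "y \<in> sector"
    then have "(1, y) \<in> lifted_cone" by (auto simp: sector_def lifted_cone_def less_imp_le)
    then show "proj_embed y \<in> (\<lambda>x. span {x}) ` chart"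
      using span_in_chart_iff[of "(1, y)"] by (simp add: proj_embed_def zero_prod_def)
  qed
  ultimately show "proj_closure sector \<subseteq> (\<lambda>x. span {x}) ` chart"
    unfolding proj_closure_def by (intro closure_of_minimal)
next
  show "(\<lambda>x. span {x}) ` chart \<subseteq> proj_closure sector"
  proof (rule image_subsetI)
    fix v assume v: "v \<in> chart"
    have vc: "v \<in> lifted_cone" using v by (simp add: chart_def)
    show "span {v} \<in> proj_closure sector"
      unfolding proj_closure_def in_closure_of topspace_proj_topology
    proof (intro conjI allI impI)
      show "span {v} \<in> proj_points" using span_singleton_proj_point chart_nonzero[OF v] by blast
      fix U assume U: "span {v} \<in> U \<and> openin proj_topology U"
      then have "open {x. x \<noteq> 0 \<and> span {x} \<in> U}" by (simp add: openin_proj_topology)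
      moreover have "v \<in> {x. x \<noteq> 0 \<and> span {x} \<in> U}" using U chart_nonzero[OF v] by blast
      ultimately obtain r where r: "0 < r" "ball v r \<subseteq> {x. x \<noteq> 0 \<and> span {x} \<in> U}"
        by (meson open_contains_ball)
      define w where "w = (1::real, y\<^sub>0)"
      have "w \<noteq> 0" by (simp add: w_def zero_prod_def)
      define \<epsilon> where "\<epsilon> = r / (2 * norm w)"
      have \<epsilon>: "0 < \<epsilon>" "norm (\<epsilon> *\<^sub>R w) < r" using r \<open>w \<noteq> 0\<close> by (auto simp: \<epsilon>_def)
      define q where "q = v + \<epsilon> *\<^sub>R w"
      have "q \<in> ball v r" using \<epsilon>(2) by (simp add: q_def dist_norm)
      then have qU: "span {q} \<in> U" using r by blast
      have q1: "0 < fst q" using lifted_cone_coords(1)[OF vc] \<epsilon>(1) by (simp add: q_def w_def)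
      define y where "y = snd q /\<^sub>R fst q"
      have "q = fst q *\<^sub>R (1, y)" using q1 by (simp add: y_def prod_eq_iff)
      moreover have "span {fst q *\<^sub>R (1, y)} = proj_embed y"
        unfolding proj_embed_def using q1 by (intro span_singleton_scale) simp
      ultimately have "span {q} = proj_embed y" by metis
      moreover have "y \<in> sector"
      proof -
        have "0 < l \<bullet> y" if "l \<in> L" for l
        proof -
          have "0 < l \<bullet> snd q"
            using vc that y0(1)[OF that] \<epsilon>(1)
            by (auto simp: q_def w_def lifted_cone_def inner_add_right intro!: add_nonneg_pos)
          then show ?thesis using q1 by (simp add: y_def)
        qed
        moreover have "0 < b + \<phi> \<bullet> y"
        proof -
          have "(b, \<phi>) \<bullet> q = (b, \<phi>) \<bullet> v + \<epsilon> * (b + \<phi> \<bullet> y\<^sub>0)"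
            by (simp add: q_def w_def inner_add_right algebra_simps)
          moreover have "0 \<le> (b, \<phi>) \<bullet> v" using vc by (simp add: lifted_cone_def)
          moreover have "0 < \<epsilon> * (b + \<phi> \<bullet> y\<^sub>0)" using \<epsilon>(1) y0(2) by simp
          ultimately have "0 < (b, \<phi>) \<bullet> q" by linarith
          moreover have "(b, \<phi>) \<bullet> q = fst q * (b + \<phi> \<bullet> y)"
            using q1 by (cases q) (simp add: y_def algebra_simps)
          ultimately show ?thesis using q1 by (simp add: zero_less_mult_iff)
        qed
        ultimately show ?thesis by (simp add: sector_def)
      qed
      ultimately show "\<exists>z. z \<in> proj_embed ` sector \<and> z \<in> U" using qU by auto
    qed
  qed
qed

text \<open>The four walls: the line at infinity, the two sides of the sector and the line \<open>b + \<phi> \<bullet> y = 0\<close>.\<close>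

lemma chart_sides:
  obtains \<alpha> \<beta> where "plane_polygon height {(1, 0), (0, \<alpha>), (0, \<beta>), (b, \<phi>)} chart"
proof -
  obtain \<alpha> \<beta> :: "real^2" where ab: "\<And>y. (\<forall>l\<in>L. 0 \<le> l \<bullet> y) \<longleftrightarrow> 0 \<le> \<alpha> \<bullet> y \<and> 0 \<le> \<beta> \<bullet> y"
    "0 < \<alpha> \<bullet> y\<^sub>0" "0 < \<beta> \<bullet> y\<^sub>0"
    using plane_cone_two_sides[OF finite_L axes y0(1)] by blast
  have "plane_polygon height {(1, 0), (0, \<alpha>), (0, \<beta>), (b, \<phi>)} chart"
  proof
    show "DIM(real \<times> (real^2)) = 3" by simp
    show "height \<noteq> 0" by (simp add: height_def zero_prod_def)
    show "finite {(1, 0), (0, \<alpha>), (0, \<beta>), (b, \<phi>)}" by simp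
    show "chart = {x. height \<bullet> x = 1 \<and> (\<forall>l\<in>{(1, 0), (0, \<alpha>), (0, \<beta>), (b, \<phi>)}. 0 \<le> l \<bullet> x)}"
      unfolding chart_def lifted_cone_def ab(1) by (auto simp: inner_prod_def)
    show "bounded chart"
    proof (rule bounded_subset)
      show "bounded ({0..1::real} \<times> cbox (0::real^2) 1)" by (intro bounded_Times bounded_closed_interval bounded_cbox)
      show "chart \<subseteq> {0..1} \<times> cbox 0 1"
      proof
        fix x assume "x \<in> chart"
        then have "x \<in> lifted_cone" "fst x + snd x $ 1 + snd x $ 2 = 1" by (auto simp: chart_def height)
        then show "x \<in> {0..1} \<times> cbox 0 1"
          using lifted_cone_coords[of x] by (cases x) (auto simp: mem_box_cart forall_2)
      qed
    qed
    have hy: "0 < height \<bullet> (1, y\<^sub>0)"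
      using y0(1)[OF axes(1)] y0(1)[OF axes(2)] by (simp add: height inner_axis')
    show "\<exists>x. height \<bullet> x = 1 \<and> (\<forall>l\<in>{(1, 0), (0, \<alpha>), (0, \<beta>), (b, \<phi>)}. 0 < l \<bullet> x)"
    proof (intro exI[of _ "(1 / (height \<bullet> (1, y\<^sub>0))) *\<^sub>R (1, y\<^sub>0)"] conjI ballI)
      show "height \<bullet> (1 / (height \<bullet> (1, y\<^sub>0))) *\<^sub>R (1, y\<^sub>0) = 1"
        unfolding inner_scaleR_right using hy by simp
      fix l assume "l \<in> {(1, 0), (0, \<alpha>), (0, \<beta>), (b, \<phi>)}"
      then have "0 < l \<bullet> (1, y\<^sub>0)" using ab(2,3) y0(2) by auto
      then show "0 < l \<bullet> (1 / (height \<bullet> (1, y\<^sub>0))) *\<^sub>R (1, y\<^sub>0)"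
        unfolding inner_scaleR_right using hy by simp
    qed
  qed
  then show ?thesis by (rule that)
qed

lemma proj_faces_sector:
  "proj_faces j (proj_closure sector) \<subseteq> (\<lambda>F. (\<lambda>x. span {x}) ` F) ` {F. F face_of chart \<and> aff_dim F = int j}"
proof (rule proj_faces_in_chart[OF _ _ proj_closure_sector])
  obtain \<alpha> \<beta> where "plane_polygon height {(1, 0), (0, \<alpha>), (0, \<beta>), (b, \<phi>)} chart" by (rule chart_sides)
  then show "convex chart" by (rule plane_polygon.convex_T)
  show "height \<bullet> x = 1" if "x \<in> chart" for x using that by (simp add: chart_def)
qed

lemma proj_polygon_sector: "proj_polygon (proj_closure sector)"
proof -
  obtain \<alpha> \<beta> where "plane_polygon height {(1, 0), (0, \<alpha>), (0, \<beta>), (b, \<phi>)} chart" by (rule chart_sides)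
  then interpret polygon: plane_polygon height "{(1, 0), (0, \<alpha>), (0, \<beta>), (b, \<phi>)}" chart .
  have "\<forall>x\<in>chart. height \<bullet> x = 1" by (simp add: chart_def)
  then show ?thesis
    unfolding proj_polygon_def chart_polytope_def
    using polygon.polytope_T polygon.aff_dim_T proj_closure_sector by blast
qed

lemma finite_proj_faces: "finite (proj_faces j (proj_closure sector))"
proof -
  obtain \<alpha> \<beta> where "plane_polygon height {(1, 0), (0, \<alpha>), (0, \<beta>), (b, \<phi>)} chart" by (rule chart_sides)
  then interpret polygon: plane_polygon height "{(1, 0), (0, \<alpha>), (0, \<beta>), (b, \<phi>)}" chart .
  have "finite {F. F face_of chart}" by (rule finite_polytope_faces[OF polygon.polytope_T])
  then show ?thesis by (intro finite_subset[OF proj_faces_sector]) auto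
qed

lemma card_vertices: "card (proj_faces 0 (proj_closure sector)) \<le> 4"
proof -
  obtain \<alpha> \<beta> where "plane_polygon height {(1, 0), (0, \<alpha>), (0, \<beta>), (b, \<phi>)} chart" by (rule chart_sides)
  then interpret polygon: plane_polygon height "{(1, 0), (0, \<alpha>), (0, \<beta>), (b, \<phi>)}" chart .
  have "proj_faces 0 (proj_closure sector) \<subseteq> (\<lambda>x. {span {x}}) ` {x. x extreme_point_of chart}"
  proof
    fix F' assume "F' \<in> proj_faces 0 (proj_closure sector)"
    then obtain F where F: "F' = (\<lambda>x. span {x}) ` F" "F face_of chart" "aff_dim F = 0"
      using proj_faces_sector[of 0] by auto
    then obtain x where "F = {x}" by (auto simp: aff_dim_eq_0)
    then show "F' \<in> (\<lambda>x. {span {x}}) ` {x. x extreme_point_of chart}"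
      using F by (auto simp: face_of_singleton)
  qed
  then have "card (proj_faces 0 (proj_closure sector)) \<le> card {x. x extreme_point_of chart}"
    using polygon.card_extreme_points(1) by (rule surj_card_le[rotated])
  also have "\<dots> \<le> card {(1, 0), (0, \<alpha>), (0, \<beta>), (b, \<phi>)}" by (rule polygon.card_extreme_points(2))
  also have "\<dots> \<le> 4" by (simp add: card_insert_if)
  finally show ?thesis .
qed

text \<open>The origin is represented by \<open>(1, 0)\<close>, at which the forms of the line at infinity and of the truncating
line take the nonzero values 1 and \<open>b\<close>.\<close>

lemma card_linear_sides: "card (linear_faces 1 (proj_closure sector)) \<le> 2"
proof -
  obtain \<alpha> \<beta> where "plane_polygon height {(1, 0), (0, \<alpha>), (0, \<beta>), (b, \<phi>)} chart" by (rule chart_sides)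
  then interpret polygon: plane_polygon height "{(1, 0), (0, \<alpha>), (0, \<beta>), (b, \<phi>)}" chart .
  let ?s = "\<lambda>l. (\<lambda>x. span {x}) ` polygon.side l"
  have "linear_faces 1 (proj_closure sector) \<subseteq> {?s (0, \<alpha>), ?s (0, \<beta>)}"
  proof
    fix F' assume "F' \<in> linear_faces 1 (proj_closure sector)"
    then have F': "F' \<in> proj_faces 1 (proj_closure sector)" "proj_embed 0 \<subseteq> span (\<Union>F')"
      by (auto simp: linear_faces_def)
    then obtain F where F: "F' = (\<lambda>x. span {x}) ` F" "F face_of chart" "aff_dim F = 1"
      using proj_faces_sector[of 1] by auto
    obtain l where l: "l \<in> {(1, 0), (0, \<alpha>), (0, \<beta>), (b, \<phi>)}" "F = polygon.side l"
      using polygon.edge_is_side[OF F(2,3)] by blast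
    have "subspace {x. l \<bullet> x = 0}" by (rule subspace_hyperplane)
    then have "span {x} \<subseteq> {x. l \<bullet> x = 0}" if "x \<in> F" for x
      using that l(2) by (intro span_minimal) (auto simp: polygon.side_def)
    then have "\<Union>F' \<subseteq> {x. l \<bullet> x = 0}" using F(1) by blast
    then have "span (\<Union>F') \<subseteq> {x. l \<bullet> x = 0}" by (intro span_minimal subspace_hyperplane)
    moreover have "(1, 0) \<in> proj_embed (0 :: real^2)" by (simp add: proj_embed_def span_base)
    ultimately have "l \<bullet> (1, 0) = 0" using F'(2) by blast
    then have "l = (0, \<alpha>) \<or> l = (0, \<beta>)" using l(1) b by auto
    then show "F' \<in> {?s (0, \<alpha>), ?s (0, \<beta>)}" using F(1) l(2) by auto
  qed
  then have "card (linear_faces 1 (proj_closure sector)) \<le> card {?s (0, \<alpha>), ?s (0, \<beta>)}"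
    by (intro card_mono) auto
  also have "\<dots> \<le> 2" by (simp add: card_insert_if)
  finally show ?thesis .
qed

lemma proj_closure_line: "proj_closure {y. b + \<phi> \<bullet> y = 0} \<subseteq> {M. \<forall>x\<in>M. (b, \<phi>) \<bullet> x = 0}"
proof -
  let ?Z = "{M \<in> proj_points. \<forall>x\<in>M. (b, \<phi>) \<bullet> x = 0}"
  have vanish: "(\<forall>z\<in>span {x}. (b, \<phi>) \<bullet> z = 0) \<longleftrightarrow> (b, \<phi>) \<bullet> x = 0" for x
    by (auto simp: span_singleton)
  have "{x. x \<noteq> 0 \<and> span {x} \<in> proj_points - ?Z} = {x. (b, \<phi>) \<bullet> x \<noteq> 0}"
  proof (intro set_eqI)
    fix x :: "real \<times> (real^2)"
    show "x \<in> {x. x \<noteq> 0 \<and> span {x} \<in> proj_points - ?Z} \<longleftrightarrow> x \<in> {x. (b, \<phi>) \<bullet> x \<noteq> 0}"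
      using span_singleton_proj_point[of x] vanish[of x] by (cases "x = 0") auto
  qed
  moreover have "open {x. (b, \<phi>) \<bullet> x \<noteq> 0}"
    by (intro open_Collect_neq continuous_intros)
  ultimately have "openin proj_topology (proj_points - ?Z)" by (simp add: openin_proj_topology)
  then have "closedin proj_topology ?Z" by (simp add: closedin_def topspace_proj_topology)
  moreover have "proj_embed ` {y. b + \<phi> \<bullet> y = 0} \<subseteq> ?Z"
  proof (rule image_subsetI)
    fix y assume "y \<in> {y. b + \<phi> \<bullet> y = 0}"
    then have "(b, \<phi>) \<bullet> (1, y) = 0" by simp
    moreover have nz: "(1::real, y) \<noteq> 0" by (simp add: zero_prod_def)
    ultimately show "proj_embed y \<in> ?Z"
      using span_singleton_proj_point[OF nz] vanish[of "(1, y)"] by (simp add: proj_embed_def)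
  qed
  ultimately have "proj_closure {y. b + \<phi> \<bullet> y = 0} \<subseteq> ?Z"
    unfolding proj_closure_def by (intro closure_of_minimal)
  then show ?thesis by blast
qed

lemma card_nonlinear_sides:
  "card {F \<in> proj_faces 1 (proj_closure sector).
     F \<subseteq> hyperplane_at_infinity \<or> F \<subseteq> proj_closure {y. b + \<phi> \<bullet> y = 0}} \<le> 2"
  (is "card ?N \<le> 2")
proof -
  obtain \<alpha> \<beta> where "plane_polygon height {(1, 0), (0, \<alpha>), (0, \<beta>), (b, \<phi>)} chart" by (rule chart_sides)
  then interpret polygon: plane_polygon height "{(1, 0), (0, \<alpha>), (0, \<beta>), (b, \<phi>)}" chart .
  let ?s = "\<lambda>l. (\<lambda>x. span {x}) ` polygon.side l"
  have "?N \<subseteq> {?s (1, 0), ?s (b, \<phi>)}"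
  proof
    fix F' assume F'N: "F' \<in> ?N"
    then obtain F where F: "F' = (\<lambda>x. span {x}) ` F" "F face_of chart" "aff_dim F = 1"
      using proj_faces_sector[of 1] by auto
    have "\<exists>l\<in>{(1, 0), (b, \<phi>)}. \<forall>M\<in>F'. \<forall>x\<in>M. l \<bullet> x = 0"
    proof (cases "F' \<subseteq> hyperplane_at_infinity")
      case True
      then have "\<forall>M\<in>F'. \<forall>x\<in>M. (1, 0) \<bullet> x = 0" by (auto simp: hyperplane_at_infinity_def inner_prod_def)
      then show ?thesis by blast
    next
      case False
      then have "F' \<subseteq> {M. \<forall>x\<in>M. (b, \<phi>) \<bullet> x = 0}" using F'N proj_closure_line by blast
      then show ?thesis by blast
    qed
    then obtain l where l: "l \<in> {(1, 0), (b, \<phi>)}" "\<And>M x. M \<in> F' \<Longrightarrow> x \<in> M \<Longrightarrow> l \<bullet> x = 0" by blast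
    have "F \<subseteq> polygon.side l"
    proof
      fix x assume x: "x \<in> F"
      then have "l \<bullet> x = 0" using l(2)[of "span {x}" x] F(1) by (simp add: span_base)
      then show "x \<in> polygon.side l" using x face_of_imp_subset[OF F(2)] by (auto simp: polygon.side_def)
    qed
    then have "F = polygon.side l" using polygon.edge_in_side[OF F(2,3), of l] l(1) by blast
    then show "F' \<in> {?s (1, 0), ?s (b, \<phi>)}" using F(1) l(1) by auto
  qed
  then have "card ?N \<le> card {?s (1, 0), ?s (b, \<phi>)}" by (intro card_mono) auto
  also have "\<dots> \<le> 2" by (simp add: card_insert_if)
  finally show ?thesis .
qed

end

text \<open>The value of \<open>b\<close> is \<open>- e\<^sub>1 e\<^sub>0\<close>, which is \<open>\<plusminus>1\<close>: in \<open>crit_form\<close> only \<open>e0\<close> contributes a constant term.\<close>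

lemma Delta_truncated_sector:
  fixes i1 :: "'n::finite" and e :: "real^'n" and c :: "real^2" and a :: "(real^'n)^2"
  assumes e0: "e0 \<in> {-1, 1}" and e: "\<And>i. e $ i \<in> {-1, 1}" and ne: "Delta i1 e0 e c a \<noteq> {}"
  shows "\<exists>L b \<phi> y\<^sub>0. truncated_sector L b \<phi> y\<^sub>0
    \<and> Delta i1 e0 e c a = truncated_sector.sector L b \<phi>
    \<and> (\<forall>y. crit_form i1 e0 e c a i1 y = b + \<phi> \<bullet> y)"
proof -
  define v where "v i = (\<chi> j. - e $ i * (c $ j * a $ j $ i))" for i
  have lin: "crit_lin e c a i y = v i \<bullet> y" for i y
    by (simp add: crit_lin_def v_def inner_vec_def sum_distrib_left mult_ac)
  define b where "b = - e $ i1 * e0"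
  define \<phi> where "\<phi> = (- e $ i1) *\<^sub>R ((\<Sum>l\<in>UNIV - {i1}. e $ l *\<^sub>R v l) + c)"
  define L where "L = {axis 1 1, axis 2 1} \<union> v ` (UNIV - {i1})"
  have form1: "crit_form i1 e0 e c a i1 y = b + \<phi> \<bullet> y" for y
  proof -
    have "c \<bullet> y = (\<Sum>j\<in>UNIV. c $ j * y $ j)" by (simp add: inner_vec_def)
    then show ?thesis
      by (simp add: crit_form_def lin b_def \<phi>_def inner_add_left inner_sum_left algebra_simps)
  qed
  have mem: "y \<in> Delta i1 e0 e c a \<longleftrightarrow> (\<forall>l\<in>L. 0 < l \<bullet> y) \<and> 0 < b + \<phi> \<bullet> y" for y
  proof -
    have "(\<forall>i. 0 < crit_form i1 e0 e c a i y) \<longleftrightarrow> 0 < b + \<phi> \<bullet> y \<and> (\<forall>i\<in>UNIV - {i1}. 0 < v i \<bullet> y)"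
      unfolding form1[symmetric] using lin by (auto simp: crit_form_def)
    then show ?thesis
      by (auto simp: Delta_def pos_orthant_def forall_2 L_def inner_axis')
  qed
  obtain y\<^sub>0 where y0: "y\<^sub>0 \<in> Delta i1 e0 e c a" using ne by blast
  have "truncated_sector L b \<phi> y\<^sub>0"
  proof
    show "finite L" by (simp add: L_def)
    show "axis 1 1 \<in> L" "axis 2 1 \<in> L" by (simp_all add: L_def)
    show "b \<noteq> 0" using e0 e[of i1] by (auto simp: b_def)
    show "\<And>l. l \<in> L \<Longrightarrow> 0 < l \<bullet> y\<^sub>0" "0 < b + \<phi> \<bullet> y\<^sub>0" using y0 mem by blast+
  qed
  moreover from this have "Delta i1 e0 e c a = truncated_sector.sector L b \<phi>"
    using mem by (auto simp: truncated_sector.sector_def)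
  ultimately show ?thesis using form1 by blast
qed


section \<open>Polynomials with n + 3 monomials\<close>

theorem theorem4p6:
  fixes f :: "'n::finite rpoly"
  assumes "2 \<le> CARD('n)"
    and "card (Poly_Mapping.keys f) = CARD('n) + 3"
    and "affine hull (Poly_Mapping.keys f) = UNIV"
    and "smooth_zero_set f"
  shows "(\<forall>(i1::'n) (e0::real) (e::real^'n) (c::real^2) (a::(real^'n)^2).
            is_normal_form_of f e0 e c a \<and> Delta i1 e0 e c a \<noteq> {} \<longrightarrow>
            (let P = proj_closure (Delta i1 e0 e c a) in
               proj_polygon P \<and>
               (\<forall>j. finite (proj_faces j P)) \<and>
               card (linear_faces 1 P) \<le> 2 \<and>
               card (nonlinear_faces 1 i1 e0 e c a) \<le> 2 \<and>
               card (proj_faces 0 P) \<le> 4))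
         \<and> finite (compact_components f)
         \<and> int (card (compact_components f)) \<le> \<lfloor>(5 * real CARD('n) + 1) / 2\<rfloor>"
proof (intro conjI allI impI)
  have *: "finite (compact_components f) \<and> 2 * card (compact_components f) \<le> 5 * CARD('n) - 2"
    by (rule compact_components_bound[OF assms])
  then show "finite (compact_components f)" by blast
  have "2 * card (compact_components f) \<le> 5 * CARD('n) + 1" using * by linarith
  then have "2 * real (card (compact_components f)) \<le> 5 * real CARD('n) + 1" by linarith
  then show "int (card (compact_components f)) \<le> \<lfloor>(5 * real CARD('n) + 1) / 2\<rfloor>"
    by (simp add: le_floor_iff)
next
  fix i1 :: 'n and e0 :: real and e :: "real^'n" and c :: "real^2" and a :: "(real^'n)^2"
  assume H: "is_normal_form_of f e0 e c a \<and> Delta i1 e0 e c a \<noteq> {}"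
  then have e: "e0 \<in> {-1, 1}" "\<And>i. e $ i \<in> {-1, 1}" by (auto simp: is_normal_form_of_def)
  obtain L b \<phi> y\<^sub>0 where sector: "truncated_sector L b \<phi> y\<^sub>0"
    and D: "Delta i1 e0 e c a = truncated_sector.sector L b \<phi>"
    and form1: "\<And>y. crit_form i1 e0 e c a i1 y = b + \<phi> \<bullet> y"
    using Delta_truncated_sector[OF e conjunct2[OF H]] by blast
  interpret truncated_sector L b \<phi> y\<^sub>0 by (rule sector)
  have "nonlinear_faces 1 i1 e0 e c a \<subseteq> {F \<in> proj_faces 1 (proj_closure sector).
     F \<subseteq> hyperplane_at_infinity \<or> F \<subseteq> proj_closure {y. b + \<phi> \<bullet> y = 0}}"
    by (auto simp: nonlinear_faces_def phi_infinity_def phi_one_def form1 D)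
  moreover have "finite {F \<in> proj_faces 1 (proj_closure sector).
     F \<subseteq> hyperplane_at_infinity \<or> F \<subseteq> proj_closure {y. b + \<phi> \<bullet> y = 0}}"
    using finite_proj_faces[of 1] by simp
  ultimately have "card (nonlinear_faces 1 i1 e0 e c a) \<le> 2"
    using card_nonlinear_sides by (metis (no_types, lifting) card_mono order_trans)
  then show "let P = proj_closure (Delta i1 e0 e c a) in
               proj_polygon P \<and>
               (\<forall>j. finite (proj_faces j P)) \<and>
               card (linear_faces 1 P) \<le> 2 \<and>
               card (nonlinear_faces 1 i1 e0 e c a) \<le> 2 \<and>
               card (proj_faces 0 P) \<le> 4"
    unfolding D Let_def
    using proj_polygon_sector finite_proj_faces card_linear_sides card_vertices by blast
qed

end
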